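(* Let $(b_N)_{N\ge1}$ be integers with $0\le b_N<N$, $b_N\to\infty$ and $b_N/N\to0$ as $N\to\infty$. Let $(a_j)_{j\in\mathbb Z}$ be random variables on one probability space satisfying either the Hermitian assumptions (H) or the real symmetric assumptions (S) given in the context, and let $T_N=(\eta_{ij}a_{i-j})_{i,j=1}^N$, where $\eta_{ij}=1$ if $|i-j|\le b_N$ and $\eta_{ij}=0$ otherwise. For $N$ with $b_N\ge1$ put $X_N=T_N/\sqrt{2b_N}$. Then: (1) $\mu_{X_N}$ converges weakly to the standard Gaussian distribution as $N\to\infty$, in the sense that for every bounded continuous $f:\mathbb R\to\mathbb R$, $$\mathbb E\Big[\int f\,\mathrm d\mu_{X_N}\Big]\to\frac1{\sqrt{2\pi}}\int_{\mathbb R} f(x)e^{-x^2/2}\,\mathrm dx.$$ (2) If in addition there exist constants $\epsilon_0>0$ and $C>0$ such that $b_N\ge C\,N^{\frac12+\epsilon_0}$ for all sufficiently large $N$, then, almost surely, $\mu_{X_N}$ converges weakly to the standard Gaussian distribution as $N\to\infty$.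
   Context: For a real symmetric or complex Hermitian $N\times N$ matrix $A$ with eigenvalues $\lambda_1,\dots,\lambda_N$, its eigenvalue distribution is the probability measure $\mu_A=\frac1N\sum_{j=1}^N\delta_{\lambda_j}$; if $A$ is random, $\mu_A$ is a random measure. Assumptions (H) (Hermitian Toeplitz case): $(a_j)_{j\in\mathbb Z}$ are complex random variables with $a_0$ real, $\operatorname{Re}a_j=\operatorname{Re}a_{-j}$ and $\operatorname{Im}a_j=-\operatorname{Im}a_{-j}$ for $j=1,2,\dots$; the family $\{a_0\}\cup\{\operatorname{Re}a_j,\operatorname{Im}a_j\}_{j\in\mathbb N}$ consists of independent real random variables; $\mathbb E[a_j]=0$ and $\mathbb E[|a_j|^2]=1$ for all $j\in\mathbb Z$; and $\sup_{j\in\mathbb Z}\mathbb E[|a_j|^k]=C_k<\infty$ for every $k\in\mathbb N$. Assumptions (S) (real symmetric Toeplitz case): $a_j=a_{-j}$ for $j=0,1,\dots$; $(a_j)_{j\ge0}$ is a sequence of independent real random variables; $\mathbb E[a_j]=0$ and $\mathbb E[|a_j|^2]=1$ for all $j\ge0$; and $\sup_{j\ge0}\mathbb E[|a_j|^k]=C_k<\infty$ for every $k\in\mathbb N$. *)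

theory Defs
  imports "HOL-Probability.Probability" "Jordan_Normal_Form.Char_Poly"
begin

text \<open>
  The measure \<open>(1/n) \<Sum> \<delta>\<^bsub>\<lambda>\<^esub>\<close>, where \<open>\<lambda>\<close> runs through the \<open>n\<close> roots of the characteristic polynomial
  with multiplicity. It is meant for Hermitian matrices of dimension \<open>n \<ge> 1\<close>, whose eigenvalues
  are real, so that \<^const>\<open>Re\<close> is only a change of type.
\<close>
definition eigenvalue_distribution :: "complex mat \<Rightarrow> real measure" where
  "eigenvalue_distribution A =
     distr (measure_pmf (pmf_of_multiset (proots (char_poly A)))) borel Re"

text \<open>
  In both sets of assumptions the moment condition uses the extended nonnegative integral, so that
  it includes integrability of all powers of \<open>\<bar>a\<^sub>j\<bar>\<close>.
  In the Hermitian case the independent family consists of \<open>Re a\<^sub>j\<close> for \<open>j \<ge> 0\<close> (left summand of the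
  index set; note \<open>Re a\<^sub>0 = a\<^sub>0\<close>) and \<open>Im a\<^sub>j\<close> for \<open>j \<ge> 1\<close> (right summand).
\<close>
definition hermitian_input :: "'a measure \<Rightarrow> (int \<Rightarrow> 'a \<Rightarrow> complex) \<Rightarrow> bool" where
  "hermitian_input M a \<longleftrightarrow>
     (\<forall>j. a j \<in> borel_measurable M) \<and>
     (\<forall>\<omega>\<in>space M. a 0 \<omega> \<in> \<real>) \<and>
     (\<forall>j\<ge>1. \<forall>\<omega>\<in>space M. Re (a j \<omega>) = Re (a (- j) \<omega>) \<and> Im (a j \<omega>) = - Im (a (- j) \<omega>)) \<and>
     prob_space.indep_vars M (\<lambda>_. borel)
       (case_sum (\<lambda>j \<omega>. Re (a j \<omega>)) (\<lambda>j \<omega>. Im (a j \<omega>))) ({0..} <+> {1..}) \<and>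
     (\<forall>j. (\<integral>\<omega>. a j \<omega> \<partial>M) = 0) \<and>
     (\<forall>j. (\<integral>\<omega>. (cmod (a j \<omega>))\<^sup>2 \<partial>M) = 1) \<and>
     (\<forall>k::nat. (SUP j. \<integral>\<^sup>+\<omega>. ennreal (cmod (a j \<omega>) ^ k) \<partial>M) < \<infinity>)"

definition symmetric_input :: "'a measure \<Rightarrow> (int \<Rightarrow> 'a \<Rightarrow> complex) \<Rightarrow> bool" where
  "symmetric_input M a \<longleftrightarrow>
     (\<forall>j. a j \<in> borel_measurable M) \<and>
     (\<forall>j. \<forall>\<omega>\<in>space M. a j \<omega> \<in> \<real>) \<and>
     (\<forall>j\<ge>0. \<forall>\<omega>\<in>space M. a j \<omega> = a (- j) \<omega>) \<and>
     prob_space.indep_vars M (\<lambda>_. borel) (\<lambda>j \<omega>. Re (a j \<omega>)) {0..} \<and>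
     (\<forall>j\<ge>0. (\<integral>\<omega>. a j \<omega> \<partial>M) = 0) \<and>
     (\<forall>j\<ge>0. (\<integral>\<omega>. (cmod (a j \<omega>))\<^sup>2 \<partial>M) = 1) \<and>
     (\<forall>k::nat. (SUP j\<in>{0..}. \<integral>\<^sup>+\<omega>. ennreal (cmod (a j \<omega>) ^ k) \<partial>M) < \<infinity>)"

definition band_toeplitz :: "nat \<Rightarrow> nat \<Rightarrow> (int \<Rightarrow> complex) \<Rightarrow> complex mat" where
  "band_toeplitz N b c =
     Matrix.mat N N (\<lambda>(i, j). if \<bar>int i - int j\<bar> \<le> int b then c (int i - int j) else 0)"

text \<open>For \<open>b = 0\<close> the factor is \<open>1/0 = 0\<close>; below, \<open>b\<close> tends to infinity with \<open>N\<close>.\<close>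
definition normalized_band_toeplitz :: "nat \<Rightarrow> nat \<Rightarrow> (int \<Rightarrow> complex) \<Rightarrow> complex mat" where
  "normalized_band_toeplitz N b c =
     complex_of_real (1 / sqrt (2 * real b)) \<cdot>\<^sub>m band_toeplitz N b c"

end

theory Submission
  imports Defs "Jordan_Normal_Form.Schur_Decomposition" "HOL-Real_Asymp.Real_Asymp"
begin

text \<open>
  The proof is by moments. Up to the normalization, the \<open>k\<close>-th moment of the eigenvalue distribution
  is \<open>(1/N) tr T\<^sup>k\<close>, a sum over closed walks on \<open>{0..<N}\<close>. Because the entries of a Toeplitz matrix
  depend only on differences of indices, such a walk contributes a product of inputs over its list
  of steps, a \<open>loop\<close> with entries in \<open>[-b, b]\<close> and sum zero, and the starting point only matters
  through the fraction \<open>weight\<close> of starts from which the walk stays inside the matrix; this fraction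
  is \<open>1 - O(b/N)\<close> (\<open>weight_bounds\<close>).

  The expectation of a loop vanishes unless each modulus of a step occurs at least twice. There are
  \<open>O(b\<^bsup>k/2\<^esup>)\<close> such matched loops, just enough to survive the factor \<open>(2 b)\<^bsup>-k/2\<^esup>\<close>. If all steps are
  paired with their opposites, the sum is zero automatically and the expectation is \<open>1\<close>; in any
  other matched loop either a modulus occurs more than twice or the vanishing of the sum is a genuine
  equation for the moduli, and either costs at least a factor \<open>b\<^bsup>1/2\<^esup>\<close> (\<open>card_matched_not_opposite_paired\<close>). The
  opposite-paired loops of length \<open>2 p\<close> are the orderings of \<open>B \<union> - B\<close> for the \<open>p\<close>-subsets \<open>B\<close> of
  \<open>{1..b}\<close>, and \<open>(2 p)! (b choose p) / (2 b)\<^sup>p\<close> tends to the Gaussian moment \<open>(2 p)! / (2\<^sup>p p!)\<close>. The same sign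
  rule explains why the real and the Hermitian case have the same limit: pairs of equal steps, whose
  expectations differ in the two cases, are negligible.

  For the almost sure statement the fourth central moment of each trace moment is expanded over
  quadruples of loops. Only quadruples that are matched jointly and in which each loop shares a
  modulus with another one contribute. Sharing makes the equations ``the sum is zero'' nontrivial;
  these and the moduli that occur more than twice remove two degrees of freedom (\<open>linked_loops_determined\<close>), so that the fourth
  central moment is \<open>O(b\<^bsup>-2\<^esup>)\<close>. Under the growth condition on \<open>b\<close> this is summable in \<open>N\<close>, whence almost sure
  convergence of all moments.

  Moments are turned into weak convergence through characteristic functions: the Taylor remainder
  of order \<open>2 p\<close> is bounded by the moment of order \<open>2 p\<close>, and for Gaussian moments this tends to
  zero with \<open>p\<close> (\<open>char_tendsto_of_moments\<close>). For the statement in expectation the argument is applied to the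
  mean of the random eigenvalue distributions, which is a probability measure because the eigenvalue
  distribution is a measurable kernel.
\<close>

section \<open>Eigenvalue power sums and traces\<close>

definition mat_trace :: "complex mat \<Rightarrow> complex" where
  "mat_trace A = (\<Sum>i<dim_row A. A $$ (i, i))"

lemma mat_trace_commute:
  assumes "P \<in> carrier_mat n n" "Q \<in> carrier_mat n n"
  shows "mat_trace (P * Q) = mat_trace (Q * P)"
proof -
  have "mat_trace (P * Q) = (\<Sum>i<n. \<Sum>j<n. P $$ (i,j) * Q $$ (j,i))"
    using assms by (auto simp: mat_trace_def scalar_prod_def lessThan_atLeast0 intro!: sum.cong)
  also have "\<dots> = (\<Sum>j<n. \<Sum>i<n. P $$ (i,j) * Q $$ (j,i))"
    by (rule sum.swap)
  also have "\<dots> = mat_trace (Q * P)"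
    using assms by (auto simp: mat_trace_def scalar_prod_def lessThan_atLeast0 mult.commute intro!: sum.cong)
  finally show ?thesis .
qed

text \<open>
  Cyclic invariance of the trace moves \<open>Q\<close> next to \<open>P\<close>, where the two cancel.
\<close>
lemma mat_trace_similar:
  assumes "similar_mat_wit A B P Q" "A \<in> carrier_mat n n"
  shows "mat_trace A = mat_trace B"
proof -
  note D = similar_mat_witD2[OF assms(2,1)]
  have "mat_trace A = mat_trace (P * (B * Q))"
    using D by (simp add: assoc_mult_mat[of P n n B n Q n])
  also have "\<dots> = mat_trace (B * Q * P)"
    using D by (intro mat_trace_commute[of _ n]) auto
  also have "B * Q * P = B * (Q * P)"
    using D by (simp add: assoc_mult_mat[of B n n Q n P n])
  also have "\<dots> = B" using D by simp
  finally show ?thesis .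
qed

lemma upper_triangular_mult:
  assumes A: "A \<in> carrier_mat n n" "upper_triangular A"
    and B: "B \<in> carrier_mat n n" "upper_triangular (B :: complex mat)"
  shows "upper_triangular (A * B)" and "i < n \<Longrightarrow> (A * B) $$ (i, i) = A $$ (i, i) * B $$ (i, i)"
proof -
  have z: "A $$ (i, l) * B $$ (l, j) = 0" if "i < n" "j < n" "l < n" "j < i \<or> (j = i \<and> l \<noteq> i)" for i j l
    using that upper_triangularD[OF A(2), of l i] upper_triangularD[OF B(2), of j l] A(1) B(1)
    by (cases "l < i") auto
  show "upper_triangular (A * B)"
  proof
    fix i j assume "j < i" "i < dim_row (A * B)"
    then show "(A * B) $$ (i, j) = 0"
      using A(1) B(1) by (auto simp: scalar_prod_def intro!: sum.neutral z)
  qed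
  assume i: "i < n"
  have "(A * B) $$ (i, i) = (\<Sum>l\<in>{0..<n}. A $$ (i, l) * B $$ (l, i))"
    using A(1) B(1) i by (auto simp: scalar_prod_def)
  also have "\<dots> = (\<Sum>l\<in>{i}. A $$ (i, l) * B $$ (l, i))"
    using i z[of i i] by (intro sum.mono_neutral_right) auto
  finally show "(A * B) $$ (i, i) = A $$ (i, i) * B $$ (i, i)" by simp
qed

lemma upper_triangular_pow:
  assumes A: "A \<in> carrier_mat n n" "upper_triangular (A :: complex mat)"
  shows "upper_triangular (A ^\<^sub>m k) \<and> (\<forall>i<n. (A ^\<^sub>m k) $$ (i, i) = A $$ (i, i) ^ k)"
proof (induction k)
  case 0
  then show ?case using A by auto
next
  case (Suc k)
  have "A ^\<^sub>m k \<in> carrier_mat n n" using A by simp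
  then show ?case
    using upper_triangular_mult[of "A ^\<^sub>m k" n A] Suc A by simp
qed

text \<open>The power sums of the eigenvalues are traces of powers, which is read off from a Schur form.\<close>
lemma sum_proots_char_poly_power:
  assumes A: "(A :: complex mat) \<in> carrier_mat n n"
  shows "(\<Sum>x\<in>#proots (char_poly A). x ^ k) = mat_trace (A ^\<^sub>m k)"
proof -
  obtain es where es: "char_poly A = (\<Prod>a\<leftarrow>es. [:- a, 1:])" and len: "length es = n"
    using char_poly_factorized[OF A] by blast
  obtain B P Q where BPQ: "schur_decomposition A es = (B, P, Q)"
    by (cases "schur_decomposition A es") auto
  note S = schur_decomposition[OF A es BPQ]
  then have wit: "similar_mat_wit A B P Q" and ut: "upper_triangular B" and diag: "diag_mat B = es"
    by auto
  have B: "B \<in> carrier_mat n n" using similar_mat_witD2[OF A wit] by auto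
  have "mat_trace (A ^\<^sub>m k) = mat_trace (B ^\<^sub>m k)"
    by (rule mat_trace_similar[OF similar_mat_wit_pow[OF wit]]) (use A in auto)
  also have "\<dots> = (\<Sum>i<n. (B $$ (i, i)) ^ k)"
    using upper_triangular_pow[OF B ut, of k] B by (simp add: mat_trace_def)
  also have "\<dots> = sum_list (map (\<lambda>x. x ^ k) es)"
    using B by (simp add: diag[symmetric] diag_mat_def interv_sum_list_conv_sum_set_nat o_def lessThan_atLeast0)
  also have "\<dots> = (\<Sum>x\<in>#mset es. x ^ k)"
    by (simp add: sum_mset_sum_list flip: mset_map)
  also have "mset es = proots (char_poly A)"
  proof -
    have "proots (\<Prod>a\<leftarrow>es. [:- a, 1:]) = mset es \<and> (\<Prod>a\<leftarrow>es. [:- a, 1:]) \<noteq> 0" for es :: "complex list"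
      by (induction es) (auto simp: proots_mult simp del: mult_pCons_left)
    then show ?thesis unfolding es by simp
  qed
  finally show ?thesis ..
qed

text \<open>
  The quadratic form \<open>v\<^sup>* A v = e v\<^sup>* v\<close> is invariant under conjugation, and \<open>v\<^sup>* v > 0\<close>.
\<close>
lemma hermitian_eigenvalue_real:
  assumes A: "(A :: complex mat) \<in> carrier_mat n n"
    and herm: "\<And>i j. i < n \<Longrightarrow> j < n \<Longrightarrow> A $$ (j, i) = cnj (A $$ (i, j))"
    and ev: "eigenvalue A e"
  shows "e \<in> \<real>"
proof -
  obtain v where v: "v \<in> carrier_vec n" "v \<noteq> 0\<^sub>v n" "A *\<^sub>v v = e \<cdot>\<^sub>v v"
    using ev A unfolding eigenvalue_def eigenvector_def by auto
  have Av: "(\<Sum>j<n. A $$ (i, j) * vec_index v j) = e * vec_index v i" if "i < n" for i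
    using arg_cong[OF v(3), of "\<lambda>w. vec_index w i"] v(1) A that
    by (simp add: scalar_prod_def lessThan_atLeast0)
  define q where "q = (\<Sum>i<n. cnj (vec_index v i) * vec_index v i)"
  have q: "q = of_real (\<Sum>i<n. (cmod (vec_index v i))\<^sup>2)"
    by (simp add: q_def mult.commute[of "cnj _"] complex_norm_square flip: of_real_power)
  obtain i0 where i0: "i0 < n" "vec_index v i0 \<noteq> 0"
    using v(1,2) by (metis carrier_vecD eq_vecI index_zero_vec(1) index_zero_vec(2))
  have "(\<Sum>i<n. (cmod (vec_index v i))\<^sup>2) > 0"
    by (rule sum_pos2[of _ i0]) (use i0 in auto)
  then have q0: "q \<noteq> 0" unfolding q of_real_eq_0_iff by simp
  have eq: "e * q = (\<Sum>i<n. \<Sum>j<n. cnj (vec_index v i) * A $$ (i, j) * vec_index v j)"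
  proof -
    have "e * q = (\<Sum>i<n. cnj (vec_index v i) * (e * vec_index v i))"
      by (simp add: q_def sum_distrib_left mult_ac)
    also have "\<dots> = (\<Sum>i<n. cnj (vec_index v i) * (\<Sum>j<n. A $$ (i, j) * vec_index v j))"
      using Av by simp
    finally show ?thesis by (simp add: sum_distrib_left mult_ac)
  qed
  have "cnj (e * q) = (\<Sum>i<n. \<Sum>j<n. cnj (vec_index v j) * A $$ (j, i) * vec_index v i)"
    unfolding eq by (simp add: mult_ac herm[symmetric])
  also have "\<dots> = e * q" unfolding eq by (rule sum.swap)
  finally have "cnj e * q = e * q" unfolding q by simp
  then show ?thesis using q0 Reals_cnj_iff by auto
qed

lemma real_distribution_eigenvalue_distribution:
  "real_distribution (eigenvalue_distribution A)"
proof -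
  interpret prob_space "eigenvalue_distribution A"
    unfolding eigenvalue_distribution_def by (rule prob_space.prob_space_distr) (auto intro: prob_space_measure_pmf)
  show ?thesis by unfold_locales (auto simp: eigenvalue_distribution_def)
qed

lemma proots_char_poly_nonempty:
  assumes "(A :: complex mat) \<in> carrier_mat n n" "n > 0"
  shows "size (proots (char_poly A)) = n" "proots (char_poly A) \<noteq> {#}"
proof -
  show "size (proots (char_poly A)) = n"
    using degree_monic_char_poly[OF assms(1)] by (simp add: size_proots_complex)
  then show "proots (char_poly A) \<noteq> {#}" using assms(2) by (auto simp flip: size_eq_0_iff_empty)
qed

lemma sum_count_mult:
  fixes f :: "'b \<Rightarrow> real"
  assumes "finite S" "set_mset M \<subseteq> S"
  shows "(\<Sum>x\<in>S. real (count M x) * f x) = (\<Sum>x\<in>#M. f x)"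
  using assms(2)
proof (induction M)
  case (add a M)
  have "(\<Sum>x\<in>S. real (count (add_mset a M) x) * f x)
      = (\<Sum>x\<in>S. real (count M x) * f x + (if x = a then f a else 0))"
    by (intro sum.cong) (auto simp: algebra_simps)
  then show ?case using add assms(1) by (simp add: sum.distrib)
qed simp

lemma integral_eigenvalue_distribution:
  fixes f :: "real \<Rightarrow> real"
  assumes A: "(A :: complex mat) \<in> carrier_mat n n" "n > 0" and f: "f \<in> borel_measurable borel"
  shows "(\<integral>x. f x \<partial>eigenvalue_distribution A) = (\<Sum>x\<in>#proots (char_poly A). f (Re x)) / n"
    and "integrable (eigenvalue_distribution A) f"
proof -
  let ?p = "proots (char_poly A)"
  note ne = proots_char_poly_nonempty[OF A]
  have "(\<integral>x. f x \<partial>eigenvalue_distribution A) = (\<integral>x. f (Re x) \<partial>measure_pmf (pmf_of_multiset ?p))"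
    unfolding eigenvalue_distribution_def using f by (subst integral_distr) auto
  also have "\<dots> = (\<Sum>x\<in>set_mset ?p. f (Re x) * pmf (pmf_of_multiset ?p) x)"
    by (rule integral_measure_pmf_real) (use ne in auto)
  also have "\<dots> = (\<Sum>x\<in>set_mset ?p. real (count ?p x) * f (Re x)) / n"
    using ne by (simp add: sum_divide_distrib mult_ac)
  also have "(\<Sum>x\<in>set_mset ?p. real (count ?p x) * f (Re x)) = (\<Sum>x\<in>#?p. f (Re x))"
    by (rule sum_count_mult) auto
  finally show "(\<integral>x. f x \<partial>eigenvalue_distribution A) = (\<Sum>x\<in>#?p. f (Re x)) / n" .
  have "integrable (measure_pmf (pmf_of_multiset ?p)) (\<lambda>x. f (Re x))"
    by (rule integrable_measure_pmf_finite) (simp add: ne(2))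
  then show "integrable (eigenvalue_distribution A) f"
    unfolding eigenvalue_distribution_def using f by (simp add: integrable_distr_eq)
qed

lemma of_real_sum_power:
  "complex_of_real (\<Sum>x\<in>#S. Re x ^ k) = (\<Sum>x\<in>#S. of_real (Re x) ^ k)"
  by (induction S) auto

text \<open>
  Here reality of the eigenvalues enters: it makes \<open>Re\<close> commute with powers.
\<close>
lemma moment_eigenvalue_distribution:
  assumes A: "(A :: complex mat) \<in> carrier_mat n n" "n > 0"
    and herm: "\<And>i j. i < n \<Longrightarrow> j < n \<Longrightarrow> A $$ (j, i) = cnj (A $$ (i, j))"
  shows "of_real (\<integral>x. x ^ k \<partial>eigenvalue_distribution A) = mat_trace (A ^\<^sub>m k) / n"
proof -
  let ?p = "proots (char_poly A)"
  have re: "of_real (Re x) = x" if "x \<in># ?p" for x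
  proof -
    have "monic (char_poly A)" using degree_monic_char_poly[OF A(1)] by blast
    then have "char_poly A \<noteq> 0" by (metis coeff_0 zero_neq_one)
    then have "poly (char_poly A) x = 0" using that by simp
    then have "eigenvalue A x" using eigenvalue_root_char_poly[OF A(1)] by blast
    then have "x \<in> \<real>" using hermitian_eigenvalue_real[OF A(1)] herm by blast
    then show ?thesis by (simp add: of_real_Re)
  qed
  have "of_real (\<integral>x. x ^ k \<partial>eigenvalue_distribution A) = complex_of_real (\<Sum>x\<in>#?p. Re x ^ k) / n"
    by (subst integral_eigenvalue_distribution[OF A]) auto
  also have "complex_of_real (\<Sum>x\<in>#?p. Re x ^ k) = (\<Sum>x\<in>#?p. of_real (Re x) ^ k)"
    by (rule of_real_sum_power)
  also have "\<dots> = (\<Sum>x\<in>#?p. x ^ k)"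
    using re by (intro arg_cong[where f = sum_mset] image_mset_cong) auto
  finally show ?thesis unfolding sum_proots_char_poly_power[OF A(1)] .
qed

section \<open>Gaussian limits from moments\<close>

definition normal_moment :: "nat \<Rightarrow> real" where
  "normal_moment k = (\<integral>x. x ^ k \<partial>std_normal_distribution)"

lemma normal_moment_even: "normal_moment (2 * p) = fact (2 * p) / (2 ^ p * fact p)"
  and normal_moment_odd: "odd k \<Longrightarrow> normal_moment k = 0"
  unfolding normal_moment_def
  using std_normal_distribution_even_moments(1) integral_std_normal_distribution_moment_odd by auto

lemma char_taylor_bound:
  assumes "real_distribution \<mu>" "\<And>k. integrable \<mu> (\<lambda>x. x ^ k)"
  shows "cmod (char \<mu> t - (\<Sum>k\<le>2 * p. (\<i> * t) ^ k / fact k * (\<integral>x. x ^ k \<partial>\<mu>)))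
           \<le> 2 * \<bar>t\<bar> ^ (2 * p) / fact (2 * p) * (\<integral>x. x ^ (2 * p) \<partial>\<mu>)"
  using real_distribution.char_approx1[OF assms(1), of "2 * p" t] assms(2)
  by (simp add: power_even_abs)

text \<open>
  The remainder is twice the \<open>p\<close>-th term of the exponential series at \<open>t\<^sup>2 / 2\<close>.
\<close>
lemma normal_moment_remainder_tendsto_0:
  "(\<lambda>p. 2 * \<bar>t\<bar> ^ (2 * p) / fact (2 * p) * normal_moment (2 * p)) \<longlonglongrightarrow> 0"
proof -
  have "(\<lambda>p. 2 * ((t\<^sup>2 / 2) ^ p / fact p)) \<longlonglongrightarrow> 2 * 0"
    by (intro tendsto_mult tendsto_const) (use summable_LIMSEQ_zero[OF summable_exp[of "t\<^sup>2 / 2"]] in \<open>simp add: field_simps\<close>)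
  then show ?thesis
    by (simp add: normal_moment_even power_mult power_divide)
qed

text \<open>
  The Taylor remainder of order \<open>2 * p\<close> is controlled by the moment of order \<open>2 * p\<close>, and for the
  normal moments that remainder vanishes as \<open>p\<close> grows; so the moments alone determine the limit.
\<close>
lemma char_tendsto_of_moments:
  fixes \<phi> :: "nat \<Rightarrow> complex" and m :: "nat \<Rightarrow> nat \<Rightarrow> real"
  assumes taylor: "\<And>n p. cmod (\<phi> n - (\<Sum>k\<le>2 * p. (\<i> * t) ^ k / fact k * m n k))
                   \<le> 2 * \<bar>t\<bar> ^ (2 * p) / fact (2 * p) * m n (2 * p)"
    and conv: "\<And>k. (\<lambda>n. m n k) \<longlonglongrightarrow> normal_moment k"
  shows "\<phi> \<longlonglongrightarrow> char std_normal_distribution t"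
proof (rule LIMSEQ_I)
  fix e :: real assume e: "e > 0"
  define R where "R p x = 2 * \<bar>t\<bar> ^ (2 * p) / fact (2 * p) * (x::real)" for p x
  define T where "T p a = (\<Sum>k\<le>2 * p. (\<i> * t) ^ k / fact k * complex_of_real (a k))" for p and a :: "nat \<Rightarrow> real"
  let ?\<gamma> = "char std_normal_distribution t"
  have "\<forall>\<^sub>F p in sequentially. R p (normal_moment (2 * p)) < e / 4"
    unfolding R_def by (rule order_tendstoD(2)[OF normal_moment_remainder_tendsto_0]) (use e in simp)
  then obtain p where p: "R p (normal_moment (2 * p)) < e / 4"
    unfolding eventually_sequentially by blast
  have g: "cmod (?\<gamma> - T p normal_moment) \<le> R p (normal_moment (2 * p))"
    using char_taylor_bound[OF real_dist_normal_dist integrable_std_normal_distribution_moment, of t p]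
    by (simp add: R_def T_def normal_moment_def)
  have "(\<lambda>n. R p (m n (2 * p))) \<longlonglongrightarrow> R p (normal_moment (2 * p))"
    unfolding R_def by (intro tendsto_intros conv)
  then have 1: "\<forall>\<^sub>F n in sequentially. R p (m n (2 * p)) < e / 4"
    using p by (rule order_tendstoD(2))
  have "(\<lambda>n. cmod (T p (m n) - T p normal_moment)) \<longlonglongrightarrow> cmod (T p normal_moment - T p normal_moment)"
    unfolding T_def by (intro tendsto_intros conv)
  then have 2: "\<forall>\<^sub>F n in sequentially. cmod (T p (m n) - T p normal_moment) < e / 4"
    using e by (intro order_tendstoD(2)) auto
  have "\<forall>\<^sub>F n in sequentially. cmod (\<phi> n - ?\<gamma>) < e"
    using 1 2
  proof eventually_elim
    case (elim n)
    have "cmod (\<phi> n - T p (m n)) \<le> R p (m n (2 * p))"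
      using taylor[of n p] by (simp add: R_def T_def)
    moreover have "\<phi> n - ?\<gamma> = (\<phi> n - T p (m n)) + (T p (m n) - T p normal_moment) - (?\<gamma> - T p normal_moment)"
      by simp
    then have "cmod (\<phi> n - ?\<gamma>) \<le> cmod (\<phi> n - T p (m n)) + cmod (T p (m n) - T p normal_moment) + cmod (?\<gamma> - T p normal_moment)"
      using norm_triangle_ineq4[of "\<phi> n - T p (m n) + (T p (m n) - T p normal_moment)" "?\<gamma> - T p normal_moment"]
        norm_triangle_ineq[of "\<phi> n - T p (m n)" "T p (m n) - T p normal_moment"] by simp
    ultimately show ?case using elim g p e by linarith
  qed
  then show "\<exists>no. \<forall>n\<ge>no. cmod (\<phi> n - ?\<gamma>) < e"
    by (simp add: eventually_sequentially)
qed

text \<open>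
  Integrability of powers is only required from some index on, since the eigenvalue distribution of
  an empty matrix is an arbitrary probability measure.
\<close>
lemma weak_conv_m_normal_of_moments:
  assumes "\<And>n. real_distribution (\<mu> n)"
    and int: "\<And>n k. n \<ge> n0 \<Longrightarrow> integrable (\<mu> n) (\<lambda>x. x ^ k)"
    and conv: "\<And>k. (\<lambda>n. \<integral>x. x ^ k \<partial>\<mu> n) \<longlonglongrightarrow> normal_moment k"
  shows "weak_conv_m \<mu> std_normal_distribution"
proof (rule levy_continuity[OF assms(1) real_dist_normal_dist])
  fix t
  have "(\<lambda>n. char (\<mu> (n + n0)) t) \<longlonglongrightarrow> char std_normal_distribution t"
  proof (rule char_tendsto_of_moments)
    show "cmod (char (\<mu> (n + n0)) t - (\<Sum>k\<le>2 * p. (\<i> * t) ^ k / fact k * (\<integral>x. x ^ k \<partial>\<mu> (n + n0))))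
        \<le> 2 * \<bar>t\<bar> ^ (2 * p) / fact (2 * p) * (\<integral>x. x ^ (2 * p) \<partial>\<mu> (n + n0))" for n p
      by (rule char_taylor_bound) (use assms(1) int in auto)
    show "(\<lambda>n. \<integral>x. x ^ k \<partial>\<mu> (n + n0)) \<longlonglongrightarrow> normal_moment k" for k
      by (rule LIMSEQ_ignore_initial_segment[OF conv])
  qed
  then show "(\<lambda>n. char (\<mu> n) t) \<longlonglongrightarrow> char std_normal_distribution t"
    by (rule LIMSEQ_offset)
qed

section \<open>Traces of powers as sums over loops\<close>

text \<open>
  The walk that starts at \<open>i\<close> and subtracts the entries of the list one by one stays in \<open>{0..<n}\<close>.
  Steps are subtracted because the matrix entry at \<open>(i, j)\<close> is indexed by \<open>i - j\<close>.
\<close>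
fun stays :: "int \<Rightarrow> int \<Rightarrow> int list \<Rightarrow> bool" where
  "stays n i [] \<longleftrightarrow> True"
| "stays n i (j # J) \<longleftrightarrow> 0 \<le> i - j \<and> i - j < n \<and> stays n (i - j) J"

definition steps :: "nat \<Rightarrow> nat \<Rightarrow> int list set" where
  "steps b k = {J. set J \<subseteq> {- int b..int b} \<and> length J = k}"

definition loops :: "nat \<Rightarrow> nat \<Rightarrow> int list set" where
  "loops b k = {J \<in> steps b k. sum_list J = 0}"

definition weight :: "nat \<Rightarrow> int list \<Rightarrow> real" where
  "weight N J = real (card {i. i < N \<and> stays (int N) (int i) J}) / real N"

lemma finite_steps [simp]: "finite (steps b k)"
  unfolding steps_def by (rule finite_lists_length_eq) simp

lemma finite_loops [simp]: "finite (loops b k)"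
  by (simp add: loops_def)

lemma sum_steps_Suc:
  fixes f :: "int list \<Rightarrow> complex"
  shows "(\<Sum>J\<in>steps b (Suc k). f J) = (\<Sum>j\<in>{- int b..int b}. \<Sum>J\<in>steps b k. f (j # J))"
proof -
  have "steps b (Suc k) = (\<lambda>(j, J). j # J) ` ({- int b..int b} \<times> steps b k)"
    by (auto simp: steps_def length_Suc_conv image_iff)
  moreover have "inj_on (\<lambda>(j, J). j # J) ({- int b..int b} \<times> steps b k)"
    by (auto simp: inj_on_def)
  ultimately have "(\<Sum>J\<in>steps b (Suc k). f J)
      = (\<Sum>(j, J)\<in>{- int b..int b} \<times> steps b k. f (j # J))"
    by (simp add: sum.reindex case_prod_unfold o_def)
  then show ?thesis by (simp add: sum.cartesian_product)
qed

lemma pow_mat_Suc_left: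
  assumes "(A :: complex mat) \<in> carrier_mat n n"
  shows "A ^\<^sub>m Suc k = A * A ^\<^sub>m k"
proof (induction k)
  case (Suc k)
  have "A ^\<^sub>m Suc (Suc k) = (A * A ^\<^sub>m k) * A" using Suc by simp
  also have "\<dots> = A * (A ^\<^sub>m k * A)"
    using assms by (intro assoc_mult_mat[of _ n n _ n _ n]) auto
  finally show ?case by simp
qed (use assms in simp)

lemma band_toeplitz_carrier [simp]: "band_toeplitz N b c \<in> carrier_mat N N"
  by (simp add: band_toeplitz_def)

text \<open>A product of matrix entries along a walk depends only on the increments of the walk.\<close>
lemma band_toeplitz_pow_entry:
  assumes "i < N" "l < N"
  shows "(band_toeplitz N b c ^\<^sub>m k) $$ (i, l)
    = (\<Sum>J\<in>steps b k. if stays (int N) (int i) J \<and> sum_list J = int i - int l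
         then prod_list (map c J) else 0)"
  using assms(1)
proof (induction k arbitrary: i)
  case 0
  have "steps b 0 = {[]}" by (auto simp: steps_def)
  then show ?case using 0 assms(2) by (auto simp: band_toeplitz_def)
next
  case (Suc k)
  let ?T = "band_toeplitz N b c"
  let ?g = "\<lambda>m J. if stays (int N) m J \<and> sum_list J = m - int l then prod_list (map c J) else 0"
  define H where "H j = (\<Sum>J\<in>steps b k. c j * ?g (int i - j) J)" for j
  have "(?T ^\<^sub>m Suc k) $$ (i, l) = (\<Sum>m<N. ?T $$ (i, m) * (?T ^\<^sub>m k) $$ (m, l))"
    using Suc.prems assms(2) carrier_matD[OF band_toeplitz_carrier[of N b c]] carrier_matD[OF pow_carrier_mat[OF band_toeplitz_carrier[of N b c], of k]]
    unfolding pow_mat_Suc_left[OF band_toeplitz_carrier]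
    by (simp add: scalar_prod_def lessThan_atLeast0)
  also have "\<dots> = (\<Sum>m<N. \<Sum>J\<in>steps b k. (if \<bar>int i - int m\<bar> \<le> int b then c (int i - int m) else 0) * ?g (int m) J)"
    using Suc by (simp add: sum_distrib_left band_toeplitz_def)
  also have "\<dots> = (\<Sum>m\<in>{m. m < N \<and> \<bar>int i - int m\<bar> \<le> int b}. H (int i - int m))"
    unfolding H_def by (rule sum.mono_neutral_cong_right) auto
  also have "\<dots> = (\<Sum>j\<in>{j \<in> {- int b..int b}. 0 \<le> int i - j \<and> int i - j < int N}. H j)"
    by (rule sum.reindex_bij_witness[of _ "\<lambda>j. nat (int i - j)" "\<lambda>m. int i - int m"]) auto
  also have "\<dots> = (\<Sum>j\<in>{- int b..int b}. if 0 \<le> int i - j \<and> int i - j < int N then H j else 0)"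
    by (rule sum.mono_neutral_cong_left) auto
  also have "\<dots> = (\<Sum>j\<in>{- int b..int b}. \<Sum>J\<in>steps b k. ?g (int i) (j # J))"
  proof (rule sum.cong[OF refl])
    fix j
    have eq: "sum_list J = int i - j - int l \<longleftrightarrow> j + sum_list J = int i - int l" for J
      by auto
    show "(if 0 \<le> int i - j \<and> int i - j < int N then H j else 0) = (\<Sum>J\<in>steps b k. ?g (int i) (j # J))"
      unfolding H_def eq by (auto intro!: sum.cong sum.neutral[symmetric])
  qed
  also have "\<dots> = (\<Sum>J\<in>steps b (Suc k). ?g (int i) J)"
    by (rule sum_steps_Suc[symmetric])
  finally show ?case .
qed

lemma mat_trace_band_toeplitz_pow:
  assumes "N > 0"
  shows "mat_trace (band_toeplitz N b c ^\<^sub>m k) / of_nat N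
    = (\<Sum>J\<in>loops b k. of_real (weight N J) * prod_list (map c J))"
proof -
  have "mat_trace (band_toeplitz N b c ^\<^sub>m k)
      = (\<Sum>i<N. \<Sum>J\<in>steps b k. if stays (int N) (int i) J \<and> sum_list J = 0 then prod_list (map c J) else 0)"
    using carrier_matD[OF pow_carrier_mat[OF band_toeplitz_carrier[of N b c], of k]]
    by (simp add: mat_trace_def band_toeplitz_pow_entry)
  also have "\<dots> = (\<Sum>J\<in>steps b k. \<Sum>i<N. if stays (int N) (int i) J \<and> sum_list J = 0 then prod_list (map c J) else 0)"
    by (rule sum.swap)
  also have "\<dots> = (\<Sum>J\<in>loops b k. \<Sum>i<N. if stays (int N) (int i) J then prod_list (map c J) else 0)"
    by (rule sum.mono_neutral_cong_right) (auto simp: loops_def)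
  also have "\<dots> = (\<Sum>J\<in>loops b k. of_nat (card {i. i < N \<and> stays (int N) (int i) J}) * prod_list (map c J))"
  proof (rule sum.cong[OF refl])
    fix J
    have "(\<Sum>i<N. if stays (int N) (int i) J then prod_list (map c J) else 0)
        = (\<Sum>i\<in>{i. i < N \<and> stays (int N) (int i) J}. prod_list (map c J))"
      by (rule sum.mono_neutral_cong_right) auto
    then show "(\<Sum>i<N. if stays (int N) (int i) J then prod_list (map c J) else 0)
        = of_nat (card {i. i < N \<and> stays (int N) (int i) J}) * prod_list (map c J)" by simp
  qed
  finally show ?thesis
    using assms by (simp add: weight_def sum_divide_distrib)
qed

text \<open>
  The normalization can be absorbed into the sequence of inputs.
\<close>
lemma normalized_band_toeplitz_altdef:
  "normalized_band_toeplitz N b c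
    = band_toeplitz N b (\<lambda>j. complex_of_real (1 / sqrt (2 * real b)) * c j)"
  by (auto simp: normalized_band_toeplitz_def band_toeplitz_def intro!: eq_matI)

lemma prod_list_map_const_mult:
  fixes s :: complex
  shows "prod_list (map (\<lambda>j. s * c j) J) = s ^ length J * prod_list (map c J)"
  by (induction J) (simp_all add: mult_ac)

lemma mat_trace_normalized_pow:
  assumes "N > 0"
  shows "mat_trace (normalized_band_toeplitz N b c ^\<^sub>m k) / of_nat N
    = complex_of_real (1 / sqrt (2 * real b)) ^ k
        * (\<Sum>J\<in>loops b k. of_real (weight N J) * prod_list (map c J))"
proof -
  define s where "s = complex_of_real (1 / sqrt (2 * real b))"
  have "mat_trace (normalized_band_toeplitz N b c ^\<^sub>m k) / of_nat N
      = (\<Sum>J\<in>loops b k. of_real (weight N J) * (s ^ length J * prod_list (map c J)))"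
    unfolding normalized_band_toeplitz_altdef mat_trace_band_toeplitz_pow[OF assms]
    by (simp only: prod_list_map_const_mult s_def)
  also have "\<dots> = s ^ k * (\<Sum>J\<in>loops b k. of_real (weight N J) * prod_list (map c J))"
    unfolding sum_distrib_left by (rule sum.cong) (auto simp: loops_def steps_def)
  finally show ?thesis unfolding s_def .
qed

lemma normalized_band_toeplitz_hermitian:
  assumes "\<And>j. c (- j) = cnj (c j)" "i < N" "j < N"
  shows "normalized_band_toeplitz N b c $$ (j, i) = cnj (normalized_band_toeplitz N b c $$ (i, j))"
  using assms(1)[of "int i - int j"] assms(2,3)
  by (simp add: normalized_band_toeplitz_altdef band_toeplitz_def abs_minus_commute)

lemma normalized_band_toeplitz_carrier [simp]: "normalized_band_toeplitz N b c \<in> carrier_mat N N"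
  by (simp add: normalized_band_toeplitz_altdef)

lemma moment_normalized_band_toeplitz:
  assumes "N > 0" "\<And>j. c (- j) = cnj (c j)"
  shows "of_real (\<integral>x. x ^ k \<partial>eigenvalue_distribution (normalized_band_toeplitz N b c))
    = complex_of_real (1 / sqrt (2 * real b)) ^ k
        * (\<Sum>J\<in>loops b k. of_real (weight N J) * prod_list (map c J))"
  unfolding mat_trace_normalized_pow[OF assms(1), symmetric]
  by (rule moment_eigenvalue_distribution[OF normalized_band_toeplitz_carrier assms(1)])
    (rule normalized_band_toeplitz_hermitian[of c, OF assms(2)])

lemma stays_of_margin:
  assumes "set J \<subseteq> {- int b..int b}" "int (length J) * int b \<le> i" "i + int (length J) * int b < n"
  shows "stays n i J"
  using assms
proof (induction J arbitrary: i)
  case (Cons j J)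
  have "stays n (i - j) J"
    using Cons.prems by (intro Cons.IH) (auto simp: algebra_simps)
  moreover define L where "L = int b * int (length J)"
  have "0 \<le> L" "- int b \<le> j" "j \<le> int b" "int b + L \<le> i" "i + (int b + L) < n"
    using Cons.prems by (simp_all add: L_def algebra_simps)
  then have "0 \<le> i - j" "i - j < n" by linarith+
  ultimately show ?case by simp
qed simp

text \<open>Only starting points within \<open>k b\<close> of the boundary can lead out of the matrix.\<close>
lemma weight_bounds:
  assumes "N > 0"
  shows "0 \<le> weight N J" "weight N J \<le> 1"
    "J \<in> steps b k \<Longrightarrow> 1 - weight N J \<le> 2 * real k * real b / real N"
proof -
  let ?A = "{i. i < N \<and> stays (int N) (int i) J}"
  show "0 \<le> weight N J" by (simp add: weight_def)
  have "card ?A \<le> card {..<N}" by (rule card_mono) auto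
  then show "weight N J \<le> 1" using assms by (simp add: weight_def)
  assume J: "J \<in> steps b k"
  have "{k * b..<N - k * b} \<subseteq> ?A"
  proof
    fix i assume i: "i \<in> {k * b..<N - k * b}"
    then have "int k * int b \<le> int i" "int i + int k * int b < int N"
      by (auto simp flip: of_nat_mult of_nat_add)
    then show "i \<in> ?A"
      using J i stays_of_margin[of J b "int i" "int N"] by (auto simp: steps_def)
  qed
  then have "card {k * b..<N - k * b} \<le> card ?A" by (intro card_mono) auto
  then have "real N - 2 * (real k * real b) \<le> real (card ?A)"
    by (simp flip: of_nat_mult)
  then have "(real N - 2 * (real k * real b)) / real N \<le> weight N J"
    unfolding weight_def using assms by (intro divide_right_mono) auto
  then show "1 - weight N J \<le> 2 * real k * real b / real N"
    using assms by (simp add: field_simps)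
qed

section \<open>Counting matched loops\<close>

text \<open>
  Together with one entry of each modulus, the sign pattern determines a tuple; and a finite index
  set has only finitely many sign patterns.
\<close>
definition sign_pattern :: "'k set \<Rightarrow> ('k \<Rightarrow> int) \<Rightarrow> ('k \<times> 'k) set \<times> ('k \<times> 'k) set" where
  "sign_pattern K v = ({(r, s) \<in> K \<times> K. v r = v s}, {(r, s) \<in> K \<times> K. v r = - v s})"

lemma sign_patternD:
  assumes "sign_pattern K v = sign_pattern K w" "r \<in> K" "s \<in> K"
  shows "v r = v s \<longleftrightarrow> w r = w s" "v r = - v s \<longleftrightarrow> w r = - w s"
  using assms unfolding sign_pattern_def by auto

lemma agree_on_class:
  assumes "sign_pattern K v = sign_pattern K w" "r \<in> K" "s \<in> K" "\<bar>v r\<bar> = \<bar>v s\<bar>" "v s = w s"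
  shows "v r = w r"
  using sign_patternD[OF assms(1-3)] assms(4,5) by linarith

text \<open>
  The counting principle: tuples that are determined, within their sign pattern, by at most \<open>m\<close> of
  their entries are \<open>O(b ^ m)\<close> in number, because there are boundedly many sign patterns.
\<close>
lemma card_le_of_determined:
  fixes v :: "'x \<Rightarrow> 'k \<Rightarrow> int"
  assumes K: "finite K"
    and bound: "\<And>x r. x \<in> A \<Longrightarrow> r \<in> K \<Longrightarrow> \<bar>v x r\<bar> \<le> int b"
    and inj: "\<And>x y. x \<in> A \<Longrightarrow> y \<in> A \<Longrightarrow> (\<And>r. r \<in> K \<Longrightarrow> v x r = v y r) \<Longrightarrow> x = y"
    and det: "\<And>x. x \<in> A \<Longrightarrow> \<exists>S\<subseteq>K. card S \<le> m \<and> (\<forall>y\<in>A. sign_pattern K (v x) = sign_pattern K (v y)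
                  \<and> (\<forall>s\<in>S. v x s = v y s) \<longrightarrow> (\<forall>r\<in>K. v x r = v y r))"
  shows "card A \<le> 2 ^ (card K * card K) * 2 ^ (card K * card K) * 2 ^ card K * (2 * b + 1) ^ m"
proof -
  define good where "good x S \<longleftrightarrow> S \<subseteq> K \<and> card S \<le> m \<and> (\<forall>y\<in>A. sign_pattern K (v x) = sign_pattern K (v y)
      \<and> (\<forall>s\<in>S. v x s = v y s) \<longrightarrow> (\<forall>r\<in>K. v x r = v y r))" for x S
  have "\<forall>x\<in>A. \<exists>S. good x S" using det unfolding good_def by blast
  from bchoice[OF this] obtain S where good: "\<forall>x\<in>A. good x (S x)" by blast
  have S: "S x \<subseteq> K" "card (S x) \<le> m" if "x \<in> A" for x
    using good that unfolding good_def by auto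
  have S_det: "\<forall>r\<in>K. v x r = v y r"
    if "x \<in> A" "y \<in> A" "sign_pattern K (v x) = sign_pattern K (v y)" "\<forall>s\<in>S x. v x s = v y s" for x y
    using good that unfolding good_def by blast
  let ?D = "{S \<in> Pow K. card S \<le> m}"
  let ?V = "SIGMA S:?D. S \<rightarrow>\<^sub>E {- int b..int b}"
  let ?P = "Pow (K \<times> K) \<times> Pow (K \<times> K)"
  define \<phi> where "\<phi> x = (sign_pattern K (v x), S x, restrict (v x) (S x))" for x
  have finD: "finite ?D" using K by simp
  have finS: "finite S'" if "S' \<in> ?D" for S' using that K by (auto intro: finite_subset)
  have finE: "finite (S' \<rightarrow>\<^sub>E {- int b..int b})" if "S' \<in> ?D" for S'
    by (rule finite_PiE[OF finS[OF that]]) simp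
  have "\<phi> ` A \<subseteq> ?P \<times> ?V"
  proof (rule image_subsetI)
    fix x assume x: "x \<in> A"
    have "restrict (v x) (S x) \<in> S x \<rightarrow>\<^sub>E {- int b..int b}"
      using bound[OF x] S(1)[OF x] by (fastforce simp: abs_le_iff)
    then show "\<phi> x \<in> ?P \<times> ?V"
      using S[OF x] unfolding \<phi>_def sign_pattern_def by auto
  qed
  moreover have "inj_on \<phi> A"
  proof (rule inj_onI)
    fix x y assume xy: "x \<in> A" "y \<in> A" "\<phi> x = \<phi> y"
    then have "sign_pattern K (v x) = sign_pattern K (v y)" "S x = S y"
      "restrict (v x) (S x) = restrict (v y) (S x)" by (auto simp: \<phi>_def)
    moreover from this(3) have "v x s = v y s" if "s \<in> S x" for s
      using that by (metis restrict_apply')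
    ultimately show "x = y" using inj[OF xy(1,2)] S_det[OF xy(1,2)] by blast
  qed
  moreover have "finite (?P \<times> ?V)"
    using K finite_SigmaI[OF finD finE] by (intro finite_cartesian_product) auto
  ultimately have "card A \<le> card (?P \<times> ?V)"
    using card_inj_on_le[of \<phi> A "?P \<times> ?V"] by blast
  also have "\<dots> = 2 ^ (card K * card K) * 2 ^ (card K * card K) * card ?V"
    using K by (simp add: card_cartesian_product card_Pow)
  also have "card ?V = (\<Sum>S\<in>?D. (2 * b + 1) ^ card S)"
  proof -
    have "card ?V = (\<Sum>S\<in>?D. card (S \<rightarrow>\<^sub>E {- int b..int b}))"
      by (rule card_SigmaI) (use finD finE in blast)+
    also have "\<dots> = (\<Sum>S\<in>?D. (2 * b + 1) ^ card S)"
      by (rule sum.cong[OF refl]) (simp add: card_PiE[OF finS] nat_add_distrib nat_mult_distrib)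
    finally show ?thesis .
  qed
  also have "\<dots> \<le> (\<Sum>S\<in>?D. (2 * b + 1) ^ m)"
    by (intro sum_mono power_increasing) auto
  also have "\<dots> \<le> 2 ^ card K * (2 * b + 1) ^ m"
  proof -
    have "card ?D \<le> card (Pow K)" using K by (intro card_mono) auto
    then show ?thesis using K by (simp add: card_Pow)
  qed
  finally show ?thesis by (simp add: mult.assoc)
qed

definition matched :: "'k set \<Rightarrow> ('k \<Rightarrow> int) \<Rightarrow> bool" where
  "matched K v \<longleftrightarrow> (\<forall>r\<in>K. \<exists>s\<in>K. s \<noteq> r \<and> \<bar>v s\<bar> = \<bar>v r\<bar>)"

abbreviation "moduli K v \<equiv> (\<lambda>r. \<bar>v r\<bar>) ` K"
abbreviation "level K v a \<equiv> {r \<in> K. \<bar>v r\<bar> = (a::int)}"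

text \<open>Each modulus of a matched tuple takes at least two positions; moduli that take more leave room for fewer moduli.\<close>
lemma card_moduli_bound:
  assumes K: "finite K" and m: "matched K v" and W: "W \<subseteq> moduli K v"
  shows "(\<Sum>a\<in>W. card (level K v a)) + 2 * card (moduli K v) \<le> card K + 2 * card W"
proof -
  let ?V = "moduli K v"
  have fin: "finite ?V" "finite W" using K W by (auto intro: finite_subset)
  have two: "2 \<le> card (level K v a)" if "a \<in> ?V" for a
  proof -
    from that obtain r where r: "r \<in> K" "a = \<bar>v r\<bar>" by auto
    with m obtain s where "s \<in> K" "s \<noteq> r" "\<bar>v s\<bar> = \<bar>v r\<bar>" unfolding matched_def by blast
    then have "card {r, s} \<le> card (level K v a)" using K r by (intro card_mono) auto
    then show ?thesis using \<open>s \<noteq> r\<close> by simp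
  qed
  have "card K = (\<Sum>a\<in>?V. card (level K v a))"
    using sum.image_gen[OF K, of "\<lambda>_. 1::nat" "\<lambda>r. \<bar>v r\<bar>"] by simp
  also have "\<dots> = (\<Sum>a\<in>W. card (level K v a)) + (\<Sum>a\<in>?V - W. card (level K v a))"
    using sum.subset_diff[OF W fin(1)] by (simp add: add.commute)
  finally have eq: "card K = \<dots>" .
  have "(\<Sum>a\<in>?V - W. card (level K v a)) \<ge> (\<Sum>a\<in>?V - W. 2)"
    using two by (intro sum_mono) auto
  then have "(\<Sum>a\<in>?V - W. card (level K v a)) \<ge> 2 * (card ?V - card W)"
    using fin W by (simp add: card_Diff_subset mult.commute)
  moreover have "card W \<le> card ?V" using fin W by (intro card_mono)
  ultimately show ?thesis using eq by linarith
qed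

text \<open>
  The entries at the positions in \<open>S\<close> determine, within the sign pattern of \<open>v\<close>, all entries whose
  modulus is not in \<open>E\<close>. The moduli in \<open>E\<close> are those to be recovered from vanishing sums.
\<close>
definition determines_outside :: "'k set \<Rightarrow> ('k \<Rightarrow> int) \<Rightarrow> 'k set \<Rightarrow> int set \<Rightarrow> bool" where
  "determines_outside K v S E \<longleftrightarrow> (\<forall>w. sign_pattern K v = sign_pattern K w \<and> (\<forall>s\<in>S. v s = w s)
     \<longrightarrow> (\<forall>r\<in>K. \<bar>v r\<bar> \<notin> E \<longrightarrow> v r = w r))"

lemma determines_outsideD:
  assumes "determines_outside K v S E" "sign_pattern K v = sign_pattern K w" "\<forall>s\<in>S. v s = w s"
    "r \<in> K" "\<bar>v r\<bar> \<notin> E"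
  shows "v r = w r"
  using assms unfolding determines_outside_def by blast

lemma obtain_representatives:
  fixes v :: "'k \<Rightarrow> int"
  assumes K: "finite K" and E: "E \<subseteq> moduli K v"
  obtains S where "S \<subseteq> K" "card S = card (moduli K v) - card E" "determines_outside K v S E"
proof -
  obtain S where S: "S \<subseteq> K" "inj_on (\<lambda>r. \<bar>v r\<bar>) S" "moduli K v - E = moduli S v"
    using subset_image_inj[of "moduli K v - E" "\<lambda>r. \<bar>v r\<bar>" K] by auto
  have "card S = card (moduli K v - E)" using S card_image by metis
  also have "\<dots> = card (moduli K v) - card E" using K E by (intro card_Diff_subset) (auto intro: finite_subset)
  finally have "card S = card (moduli K v) - card E" .
  moreover have "v r = w r" if "sign_pattern K v = sign_pattern K w" "\<And>s. s \<in> S \<Longrightarrow> v s = w s"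
    "r \<in> K" "\<bar>v r\<bar> \<notin> E" for w r
  proof -
    have "\<bar>v r\<bar> \<in> moduli S v" using that S(3) by auto
    then obtain s where "s \<in> S" "\<bar>v r\<bar> = \<bar>v s\<bar>" by auto
    then show ?thesis using agree_on_class[OF that(1) that(3), of s] that(2) S(1) by auto
  qed
  ultimately show ?thesis using that[of S] S(1) unfolding determines_outside_def by blast
qed

lemma sum_eq_0_determines:
  fixes v w :: "'k \<Rightarrow> int"
  assumes "finite L" "sum v L = 0" "sum w L = 0" "T \<subseteq> L" "\<And>t. t \<in> L - T \<Longrightarrow> v t = w t"
  shows "sum v T = sum w T"
proof -
  have "sum v L = sum v (L - T) + sum v T" "sum w L = sum w (L - T) + sum w T"
    using sum.subset_diff[OF assms(4,1)] by auto
  moreover have "sum v (L - T) = sum w (L - T)" using assms(5) by (rule sum.cong[OF refl])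
  ultimately show ?thesis using assms(2,3) by linarith
qed

definition opposite_paired :: "int list \<Rightarrow> bool" where
  "opposite_paired J \<longleftrightarrow> distinct J \<and> 0 \<notin> set J \<and> (\<forall>x\<in>set J. - x \<in> set J)"

abbreviation "matched_list J \<equiv> matched {..<length J} ((!) J)"

lemma sum_list_eq_sum_nth: "sum_list J = sum ((!) J) {..<length J}"
  by (simp add: sum_list_sum_nth lessThan_atLeast0)

lemma loops_length: "J \<in> loops b k \<Longrightarrow> length J = k"
  by (simp add: loops_def steps_def)

lemma loops_nth_bound:
  assumes "J \<in> loops b k" "r < k"
  shows "\<bar>J ! r\<bar> \<le> int b"
proof -
  have "J ! r \<in> set J" using assms loops_length[OF assms(1)] by simp
  then have "J ! r \<in> {- int b..int b}" using assms(1) unfolding loops_def steps_def by blast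
  then show ?thesis by auto
qed

text \<open>
  An upper bound for the number of pairs of a sign pattern on \<open>n\<close> positions and a set of positions.
\<close>
definition pattern_bound :: "nat \<Rightarrow> nat" where
  "pattern_bound n = 2 ^ (n * n) * 2 ^ (n * n) * 2 ^ n"

text \<open>
  Unless all entries are paired with their opposites, the vanishing of the sum is a genuine
  constraint, or some modulus occurs at least three times: in both cases there is less freedom.
\<close>
lemma card_matched_not_opposite_paired:
  "card {J \<in> loops b k. matched_list J \<and> \<not> opposite_paired J}
     \<le> pattern_bound k * (2 * b + 1) ^ ((k - 1) div 2)"
proof -
  let ?A = "{J \<in> loops b k. matched_list J \<and> \<not> opposite_paired J}" and ?K = "{..<k}"
  have len: "length J = k" if "J \<in> ?A" for J using that by (auto simp: loops_def steps_def)
  have sum0: "sum ((!) J) ?K = 0" if "J \<in> ?A" for J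
    using that len[OF that] by (auto simp: loops_def sum_list_eq_sum_nth)
  have "card ?A \<le> 2 ^ (card ?K * card ?K) * 2 ^ (card ?K * card ?K) * 2 ^ card ?K * (2 * b + 1) ^ ((k - 1) div 2)"
  proof (rule card_le_of_determined[where v = "(!)"])
    show "\<bar>J ! r\<bar> \<le> int b" if "J \<in> ?A" "r \<in> ?K" for J r
      using that loops_nth_bound by auto
    show "J = I" if "J \<in> ?A" "I \<in> ?A" "\<And>r. r \<in> ?K \<Longrightarrow> J ! r = I ! r" for J I
      by (rule nth_equalityI) (use that(3) len[OF that(1)] len[OF that(2)] in simp_all)
    fix J assume J: "J \<in> ?A"
    then have m: "matched ?K ((!) J)" using len[OF J] by simp
    let ?V = "moduli ?K ((!) J)"
    have n: "2 * card ?V \<le> k" using card_moduli_bound[OF _ m, of "{}"] by simp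
    show "\<exists>S\<subseteq>?K. card S \<le> (k - 1) div 2 \<and> (\<forall>I\<in>?A. sign_pattern ?K ((!) J) = sign_pattern ?K ((!) I)
        \<and> (\<forall>s\<in>S. J ! s = I ! s) \<longrightarrow> (\<forall>r\<in>?K. J ! r = I ! r))"
    proof (cases "2 * card ?V = k")
      case False
      obtain S where S: "S \<subseteq> ?K" "card S = card ?V - card ({}::int set)"
        "determines_outside ?K ((!) J) S {}"
        using obtain_representatives[of ?K "{}" "(!) J"] by blast
      have "card S \<le> (k - 1) div 2" using S(2) n False by simp
      then show ?thesis using S(1) determines_outsideD[OF S(3)] by blast
    next
      case True
      have two: "card (level ?K ((!) J) a) \<le> 2" if "a \<in> ?V" for a
        using card_moduli_bound[OF _ m, of "{a}"] that True by simp
      obtain r s where rs: "r \<in> ?K" "s \<in> ?K" "r \<noteq> s" "J ! r = J ! s"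
      proof -
        \<comment> \<open>Otherwise matching entries are always opposite, and then the list is opposite-paired.\<close>
        have "\<exists>r\<in>?K. \<exists>s\<in>?K. r \<noteq> s \<and> J ! r = J ! s"
        proof (rule ccontr)
          assume neg: "\<not> ?thesis"
          then have "distinct J" using len[OF J] by (auto simp: distinct_conv_nth)
          moreover have "x \<noteq> 0 \<and> - x \<in> set J" if "x \<in> set J" for x
          proof -
            from that obtain r where r: "r < k" "x = J ! r" using len[OF J] by (metis in_set_conv_nth)
            with m obtain s where s: "s < k" "s \<noteq> r" "\<bar>J ! s\<bar> = \<bar>J ! r\<bar>"
              unfolding matched_def by blast
            with neg r have "J ! s \<noteq> J ! r" by auto
            with s have "J ! s = - x" "x \<noteq> 0" unfolding r by linarith+
            then show ?thesis using s(1) len[OF J] by (metis nth_mem)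
          qed
          ultimately show False using J unfolding opposite_paired_def by auto
        qed
        then show ?thesis using that by blast
      qed
      let ?a = "\<bar>J ! r\<bar>"
      have lev: "level ?K ((!) J) ?a = {r, s}"
      proof -
        have "{r, s} \<subseteq> level ?K ((!) J) ?a" using rs by auto
        moreover have "card (level ?K ((!) J) ?a) \<le> card {r, s}" using two[of ?a] rs by simp
        ultimately show ?thesis using card_seteq[of "level ?K ((!) J) ?a" "{r, s}"] by simp
      qed
      have a: "{?a} \<subseteq> ?V" using rs by auto
      obtain S where S: "S \<subseteq> ?K" "card S = card ?V - card {?a}"
        "determines_outside ?K ((!) J) S {?a}"
        using obtain_representatives[OF finite_lessThan a] by blast
      have "card S \<le> (k - 1) div 2" using S(2) True by simp
      moreover have "J ! t = I ! t" if I: "I \<in> ?A" and sp: "sign_pattern ?K ((!) J) = sign_pattern ?K ((!) I)"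
        and eq: "\<forall>s\<in>S. J ! s = I ! s" and t: "t \<in> ?K" for I t
      proof (cases "\<bar>J ! t\<bar> = ?a")
        case False
        then show ?thesis using determines_outsideD[OF S(3) sp eq t] by blast
      next
        case True
        \<comment> \<open>The equal entries at \<open>r\<close> and \<open>s\<close> are half of minus the sum of the others.\<close>
        have "sum ((!) J) {r, s} = sum ((!) I) {r, s}"
        proof (rule sum_eq_0_determines[OF _ sum0[OF J] sum0[OF I]])
          show "J ! t = I ! t" if "t \<in> ?K - {r, s}" for t
            using determines_outsideD[OF S(3) sp eq, of t] that lev by blast
        qed (use rs in auto)
        moreover have "I ! r = I ! s" using sign_patternD(1)[OF sp rs(1,2)] rs(4) by simp
        ultimately have "J ! r = I ! r" using rs(3,4) by simp
        then show ?thesis using agree_on_class[OF sp t rs(1) True] by blast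
      qed
      ultimately show ?thesis using S(1) by blast
    qed
  qed simp
  then show ?thesis by (simp add: pattern_bound_def)
qed

section \<open>Opposite-paired loops\<close>

lemma opposite_paired_set:
  assumes "opposite_paired J"
  defines "B \<equiv> {x \<in> set J. 0 < x}"
  shows "set J = B \<union> uminus ` B" "length J = 2 * card B"
proof -
  have *: "distinct J" "0 \<notin> set J" "\<And>x. x \<in> set J \<Longrightarrow> - x \<in> set J"
    using assms(1) by (auto simp: opposite_paired_def)
  show eq: "set J = B \<union> uminus ` B"
  proof
    show "set J \<subseteq> B \<union> uminus ` B"
    proof
      fix x assume x: "x \<in> set J"
      show "x \<in> B \<union> uminus ` B"
      proof (cases "x > 0")
        case False
        moreover have "x \<noteq> 0" using x *(2) by blast
        ultimately have "- x \<in> B" using x *(3) by (simp add: B_def)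
        then have "- (- x) \<in> uminus ` B" by (rule imageI)
        then show ?thesis by simp
      qed (use x in \<open>simp add: B_def\<close>)
    qed
  qed (use *(3) in \<open>auto simp: B_def\<close>)
  have "length J = card (B \<union> uminus ` B)" using distinct_card[OF *(1)] eq by simp
  also have "\<dots> = card B + card (uminus ` B)"
    by (rule card_Un_disjoint) (auto simp: B_def)
  also have "card (uminus ` B) = card B" by (rule card_image) simp
  finally show "length J = 2 * card B" by simp
qed

lemma sum_list_opposite_paired:
  assumes "opposite_paired J"
  shows "sum_list J = 0"
proof -
  have "sum_list J = (\<Sum>x\<in>set J. x)"
    using assms by (simp add: opposite_paired_def sum_list_distinct_conv_sum_set[of J "\<lambda>x. x", simplified])
  moreover have "(\<Sum>x\<in>set J. x) = (\<Sum>x\<in>set J. - x)"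
    by (rule sum.reindex_bij_witness[of _ uminus uminus]) (use assms in \<open>auto simp: opposite_paired_def\<close>)
  then have "(\<Sum>x\<in>set J. x) = - (\<Sum>x\<in>set J. x)" by (simp only: sum_negf)
  ultimately show ?thesis by linarith
qed

text \<open>
  An opposite-paired list of length \<open>2 * p\<close> is an ordering of \<open>B \<union> - B\<close> for some \<open>p\<close>-subset \<open>B\<close>
  of \<open>{1..b}\<close>.
\<close>
lemma card_opposite_paired_even:
  "card {J \<in> loops b (2 * p). opposite_paired J} = fact (2 * p) * (b choose p)"
proof -
  let ?\<B> = "{B. B \<subseteq> {1..int b} \<and> card B = p}"
  have sets: "finite (B \<union> uminus ` B)" "card (B \<union> uminus ` B) = 2 * p"
    "B = {x \<in> B \<union> uminus ` B. 0 < x}" if "B \<in> ?\<B>" for B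
  proof -
    have f: "finite B" using that by (auto intro: finite_subset)
    then show "finite (B \<union> uminus ` B)" by simp
    have "card (B \<union> uminus ` B) = card B + card (uminus ` B)"
    proof (rule card_Un_disjoint)
      have ge: "x \<ge> 1" if "x \<in> B" for x using that \<open>B \<in> ?\<B>\<close> by auto
      have "x \<notin> uminus ` B" if x: "x \<in> B" for x
      proof
        assume "x \<in> uminus ` B"
        then obtain y where "y \<in> B" "x = - y" by blast
        then show False using ge[of y] ge[OF x] by linarith
      qed
      then show "B \<inter> uminus ` B = {}" by blast
    qed (use f in auto)
    also have "card (uminus ` B) = card B" by (rule card_image) simp
    finally show "card (B \<union> uminus ` B) = 2 * p" using that by simp
    show "B = {x \<in> B \<union> uminus ` B. 0 < x}" using that by auto
  qed
  have "{J \<in> loops b (2 * p). opposite_paired J} = (\<Union>B\<in>?\<B>. permutations_of_set (B \<union> uminus ` B))" (is "?L = ?R")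
  proof (intro equalityI subsetI)
    fix J assume J: "J \<in> ?L"
    define B where "B = {x \<in> set J. 0 < x}"
    have "set J = B \<union> uminus ` B" "length J = 2 * card B"
      using opposite_paired_set[of J] J by (auto simp: B_def)
    moreover have "B \<in> ?\<B>"
      using J \<open>length J = 2 * card B\<close> by (auto simp: B_def loops_def steps_def)
    ultimately show "J \<in> ?R" using J by (auto intro!: permutations_of_setI bexI[of _ B] simp: opposite_paired_def)
  next
    fix J assume "J \<in> ?R"
    then obtain B where "B \<in> ?\<B>" "J \<in> permutations_of_set (B \<union> uminus ` B)" by blast
    then have B: "B \<in> ?\<B>" "set J = B \<union> uminus ` B" "distinct J"
      using permutations_of_setD by blast+
    then have op: "opposite_paired J" by (auto simp: opposite_paired_def)
    moreover have "length J = 2 * p" using B sets(2)[OF B(1)] distinct_card[OF B(3)] by simp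
    moreover have "set J \<subseteq> {- int b..int b}" using B by auto
    ultimately show "J \<in> ?L" by (simp add: loops_def steps_def sum_list_opposite_paired)
  qed
  also have "card ?R = (\<Sum>B\<in>?\<B>. card (permutations_of_set (B \<union> uminus ` B)))"
  proof (rule card_UN_disjoint)
    show "finite ?\<B>" by (rule finite_subset[of _ "Pow {1..int b}"]) auto
    show "\<forall>B\<in>?\<B>. \<forall>C\<in>?\<B>. B \<noteq> C \<longrightarrow>
        permutations_of_set (B \<union> uminus ` B) \<inter> permutations_of_set (C \<union> uminus ` C) = {}"
    proof (intro ballI impI, rule ccontr)
      fix B C assume BC: "B \<in> ?\<B>" "C \<in> ?\<B>" "B \<noteq> C"
        "permutations_of_set (B \<union> uminus ` B) \<inter> permutations_of_set (C \<union> uminus ` C) \<noteq> {}"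
      then have "B \<union> uminus ` B = C \<union> uminus ` C" by (auto dest!: permutations_of_setD(1))
      then show False using sets(3)[OF BC(1)] sets(3)[OF BC(2)] BC(3) by simp
    qed
  qed auto
  also have "\<dots> = (\<Sum>B\<in>?\<B>. fact (2 * p))"
    by (intro sum.cong refl) (use sets in \<open>simp only: card_permutations_of_set\<close>)
  also have "\<dots> = fact (2 * p) * (b choose p)"
    using n_subsets[of "{1..int b}" p] by simp
  finally show ?thesis .
qed

lemma not_opposite_paired_odd: "odd k \<Longrightarrow> J \<in> loops b k \<Longrightarrow> \<not> opposite_paired J"
  using opposite_paired_set(2)[of J] loops_length[of J b k] by auto

section \<open>Linked quadruples of loops\<close>

abbreviation positions :: "nat \<Rightarrow> (nat \<times> nat) set" where
  "positions k \<equiv> {..<4} \<times> {..<k}"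

definition joint :: "(nat \<Rightarrow> int list) \<Rightarrow> nat \<times> nat \<Rightarrow> int" where
  "joint G = (\<lambda>(i, r). G i ! r)"

text \<open>
  The necessary condition for a quadruple of loops to contribute to a fourth central moment.
\<close>
definition linked :: "nat \<Rightarrow> (nat \<Rightarrow> int list) \<Rightarrow> bool" where
  "linked k G \<longleftrightarrow> matched (positions k) (joint G) \<and>
     (\<forall>i<4. \<exists>r<k. \<exists>i'<4. \<exists>r'<k. i' \<noteq> i \<and> \<bar>G i' ! r'\<bar> = \<bar>G i ! r\<bar>)"

lemma linkedE:
  assumes "linked k G" "i < 4"
  obtains p q where "p \<in> positions k" "q \<in> positions k" "fst p = i" "fst q \<noteq> i" "\<bar>joint G p\<bar> = \<bar>joint G q\<bar>"
proof -
  from assms obtain r i' r' where "r < k" "i' < 4" "r' < k" "i' \<noteq> i" "\<bar>G i' ! r'\<bar> = \<bar>G i ! r\<bar>"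
    unfolding linked_def by blast
  then show ?thesis using that[of "(i, r)" "(i', r')"] assms(2) by (simp add: joint_def)
qed

abbreviation "loop_row k i \<equiv> {p \<in> positions k. fst p = (i::nat)}"

lemma sum_row:
  assumes "length (G i) = k" "i < 4"
  shows "sum (joint G) (loop_row k i) = sum_list (G i)"
proof -
  have "loop_row k i = Pair i ` {..<k}" using assms(2) by auto
  then show ?thesis using assms(1)
    by (simp add: sum.reindex inj_on_def joint_def sum_list_eq_sum_nth)
qed

text \<open>
  The sum of the row vanishes, which determines a modulus that occurs only once in the row.
\<close>
lemma agree_on_row:
  fixes v w :: "nat \<times> nat \<Rightarrow> int"
  assumes "sum v (loop_row k i) = 0" "sum w (loop_row k i) = 0" "loop_row k i \<inter> level (positions k) v a = {p}"
    and sp: "sign_pattern (positions k) v = sign_pattern (positions k) w"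
    and agree: "\<And>q. q \<in> loop_row k i \<Longrightarrow> \<bar>v q\<bar> \<noteq> a \<Longrightarrow> v q = w q"
    and q: "q \<in> positions k" "\<bar>v q\<bar> = a"
  shows "v q = w q"
proof -
  have p: "p \<in> positions k" "p \<in> loop_row k i" "\<bar>v p\<bar> = a" using assms(3) by auto
  have fin: "finite (loop_row k i)" by simp
  have "sum v {p} = sum w {p}"
  proof (rule sum_eq_0_determines[OF fin assms(1,2)])
    show "v t = w t" if "t \<in> loop_row k i - {p}" for t
      using agree[of t] that assms(3) by blast
  qed (use p in auto)
  then show ?thesis using agree_on_class[OF sp q(1) p(1)] p(3) q(2) by simp
qed

text \<open>
  Either the moduli of four linked loops are fewer than the \<open>2 * k\<close> that matching alone permits, or
  the vanishing sums determine one or two of them.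
\<close>
lemma linked_loops_determined:
  assumes loop: "\<And>i. i < 4 \<Longrightarrow> G i \<in> loops b k" and l: "linked k G"
  defines "K \<equiv> positions k"
  shows "\<exists>S\<subseteq>K. card S \<le> 2 * k - 2 \<and> (\<forall>H. (\<forall>i<4. H i \<in> loops b k) \<and>
     sign_pattern K (joint G) = sign_pattern K (joint H) \<and> (\<forall>s\<in>S. joint G s = joint H s)
     \<longrightarrow> (\<forall>r\<in>K. joint G r = joint H r))"
proof -
  let ?v = "joint G"
  let ?V = "moduli K ?v"
  have K: "finite K" "card K = 4 * k" by (auto simp: K_def card_cartesian_product)
  have m: "matched K ?v" using l by (auto simp: linked_def K_def)
  have n: "card ?V \<le> 2 * k" using card_moduli_bound[OF K(1) m, of "{}"] K(2) by simp
  have row0: "sum (joint H) (loop_row k i) = 0" if "\<forall>i<4. H i \<in> loops b k" "i < 4" for H i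
    using that sum_row[of H i k] loops_length[of "H i" b k] by (auto simp: loops_def)
  have rowG: "sum ?v (loop_row k i) = 0" if "i < 4" for i using row0[of G i] loop that by blast
  have finlev: "finite (level K ?v a)" for a using K by simp
  consider "card ?V \<le> 2 * k - 2" | "k > 0" "card ?V = 2 * k - 1" | "k > 0" "card ?V = 2 * k"
    using n by (cases "k = 0") linarith+
  then show ?thesis
  proof cases
    case 1
    obtain S where S: "S \<subseteq> K" "card S = card ?V - card ({}::int set)" "determines_outside K ?v S {}"
      using obtain_representatives[OF K(1), of "{}" ?v] by blast
    then have "card S \<le> 2 * k - 2" using 1 by simp
    then show ?thesis using S(1) determines_outsideD[OF S(3)] by blast
  next
    case 2
    have "\<exists>a i p. i < 4 \<and> a \<in> ?V \<and> loop_row k i \<inter> level K ?v a = {p}"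
    proof (rule ccontr)
      assume neg: "\<not> ?thesis"
      \<comment> \<open>Otherwise a shared modulus occurs at least twice in each row that it meets, hence at least
        four times. Two such moduli, or one that meets three rows, take up more than the two positions
        that are left when each of the \<open>2 * k - 1\<close> moduli has its minimum of two.\<close>
      have cross: "\<exists>a\<in>?V. \<exists>j. j \<noteq> i \<and> j < 4 \<and> card (loop_row k i \<inter> level K ?v a) \<ge> 2 \<and> card (loop_row k j \<inter> level K ?v a) \<ge> 2"
        if i: "i < 4" for i
      proof -
        obtain p q where pq: "p \<in> K" "q \<in> K" "fst p = i" "fst q \<noteq> i" "\<bar>?v p\<bar> = \<bar>?v q\<bar>"
          using linkedE[OF l i] unfolding K_def by metis
        have two: "card (loop_row k (fst s) \<inter> level K ?v \<bar>?v p\<bar>) \<ge> 2" if s: "s \<in> K" "\<bar>?v s\<bar> = \<bar>?v p\<bar>" for s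
        proof -
          let ?R = "loop_row k (fst s) \<inter> level K ?v \<bar>?v p\<bar>"
          have "s \<in> ?R" "finite ?R" using s by (auto simp: K_def)
          moreover have "fst s < 4" using s by (auto simp: K_def)
          then have "\<not> (\<exists>t. ?R = {t})" using neg pq(1) by blast
          ultimately have "card ?R \<noteq> 0" "card ?R \<noteq> 1" by (auto simp: card_1_singleton_iff)
          then show ?thesis by linarith
        qed
        have "fst q < 4" using pq by (auto simp: K_def)
        then show ?thesis using two[of p] two[of q] pq
          by (intro bexI[of _ "\<bar>?v p\<bar>"] exI[of _ "fst q"]) auto
      qed
      obtain a j where a: "a \<in> ?V" "j \<noteq> 0" "j < 4" "card (loop_row k 0 \<inter> level K ?v a) \<ge> 2"
        "card (loop_row k j \<inter> level K ?v a) \<ge> 2" using cross[of 0] by auto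
      define l where "l = (if j = 1 then 2 else 1 :: nat)"
      have lj: "l < 4" "l \<noteq> 0" "l \<noteq> j" by (auto simp: l_def)
      obtain a' j' where a': "a' \<in> ?V" "j' \<noteq> l" "card (loop_row k l \<inter> level K ?v a') \<ge> 2"
        "card (loop_row k j' \<inter> level K ?v a') \<ge> 2" using cross[OF lj(1)] by auto
      have union: "card (loop_row k i \<inter> level K ?v c) + card (loop_row k i' \<inter> level K ?v c) \<le> card (level K ?v c)"
        if "i \<noteq> i'" for i i' c
      proof -
        have "card ((loop_row k i \<inter> level K ?v c) \<union> (loop_row k i' \<inter> level K ?v c))
            = card (loop_row k i \<inter> level K ?v c) + card (loop_row k i' \<inter> level K ?v c)"
          by (rule card_Un_disjoint) (use that in auto)
        moreover have "card ((loop_row k i \<inter> level K ?v c) \<union> (loop_row k i' \<inter> level K ?v c)) \<le> card (level K ?v c)"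
          by (rule card_mono[OF finlev]) auto
        ultimately show ?thesis by simp
      qed
      have four: "card (level K ?v a) \<ge> 4" "card (level K ?v a') \<ge> 4"
        using union[of 0 j a] union[of l j' a'] a a' by auto
      show False
      proof (cases "a = a'")
        case False
        then have "4 + 4 + 2 * card ?V \<le> 4 * k + 2 * 2"
          using card_moduli_bound[OF K(1) m, of "{a, a'}"] a(1) a'(1) four K(2) by simp
        then show False using 2 by linarith
      next
        case True
        have "card ((loop_row k 0 \<inter> level K ?v a) \<union> (loop_row k j \<inter> level K ?v a) \<union> (loop_row k l \<inter> level K ?v a))
            = card (loop_row k 0 \<inter> level K ?v a) + card (loop_row k j \<inter> level K ?v a) + card (loop_row k l \<inter> level K ?v a)"
          by (subst card_Un_disjoint; (subst card_Un_disjoint)?) (use a lj in auto)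
        moreover have "card ((loop_row k 0 \<inter> level K ?v a) \<union> (loop_row k j \<inter> level K ?v a) \<union> (loop_row k l \<inter> level K ?v a))
            \<le> card (level K ?v a)"
          by (rule card_mono[OF finlev]) auto
        ultimately have "6 \<le> card (level K ?v a)" using a(4,5) a'(3)[folded True] by linarith
        then have "6 + 2 * card ?V \<le> 4 * k + 2"
          using card_moduli_bound[OF K(1) m, of "{a}"] a(1) K(2) by simp
        then show False using 2 by linarith
      qed
    qed
    then obtain a i p where a: "i < 4" "{a} \<subseteq> ?V" "loop_row k i \<inter> level K ?v a = {p}" by blast
    obtain S where S: "S \<subseteq> K" "card S = card ?V - card {a}" "determines_outside K ?v S {a}"
      using obtain_representatives[OF K(1) a(2)] by blast
    have "joint G r = joint H r" if H: "\<forall>i<4. H i \<in> loops b k"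
      and sp: "sign_pattern K ?v = sign_pattern K (joint H)" and eq: "\<forall>s\<in>S. ?v s = joint H s" and r: "r \<in> K" for H r
    proof (cases "\<bar>?v r\<bar> = a")
      case False
      then show ?thesis using determines_outsideD[OF S(3) sp eq r] by blast
    next
      case True
      show ?thesis
      proof (rule agree_on_row[OF rowG[OF a(1)] row0[OF H a(1)] a(3)[unfolded K_def] sp[unfolded K_def] _ r[unfolded K_def] True])
        show "?v q = joint H q" if "q \<in> loop_row k i" "\<bar>?v q\<bar> \<noteq> a" for q
          using determines_outsideD[OF S(3) sp eq, of q] that by (auto simp: K_def)
      qed
    qed
    moreover have "card S \<le> 2 * k - 2" using S(2) 2 by simp
    ultimately show ?thesis using S(1) by blast
  next
    case 3
    have two: "card (level K ?v a) \<le> 2" if "a \<in> ?V" for a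
      using card_moduli_bound[OF K(1) m, of "{a}"] that 3 K(2) by simp
    have pair: "level K ?v \<bar>?v p\<bar> = {p, q}" if "p \<in> K" "q \<in> K" "p \<noteq> q" "\<bar>?v p\<bar> = \<bar>?v q\<bar>" for p q
    proof -
      have "{p, q} \<subseteq> level K ?v \<bar>?v p\<bar>" using that by auto
      moreover have "card (level K ?v \<bar>?v p\<bar>) \<le> card {p, q}" using two[of "\<bar>?v p\<bar>"] that by simp
      ultimately show ?thesis using card_seteq[OF finlev] by blast
    qed
    obtain p q where pq: "p \<in> K" "q \<in> K" "fst p = 0" "fst q \<noteq> 0" "\<bar>?v p\<bar> = \<bar>?v q\<bar>"
      using linkedE[OF assms(2), of 0] unfolding K_def by (metis zero_less_numeral)
    \<comment> \<open>All moduli occur exactly twice. A row \<open>l\<close> other than the two rows of \<open>p\<close> and \<open>q\<close> gives an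
      equation that does not involve their modulus, so its shared modulus is eliminated first.\<close>
    define l where "l = (if fst q = 1 then 2 else 1 :: nat)"
    have lq: "l < 4" "l \<noteq> 0" "l \<noteq> fst q" by (auto simp: l_def)
    obtain p' q' where pq': "p' \<in> K" "q' \<in> K" "fst p' = l" "fst q' \<noteq> l" "\<bar>?v p'\<bar> = \<bar>?v q'\<bar>"
      using linkedE[OF assms(2) lq(1)] unfolding K_def by metis
    let ?a = "\<bar>?v p\<bar>" and ?a' = "\<bar>?v p'\<bar>"
    have lev: "level K ?v ?a = {p, q}" "level K ?v ?a' = {p', q'}"
    proof -
      have "p \<noteq> q" "p' \<noteq> q'" using pq pq' by fastforce+
      then show "level K ?v ?a = {p, q}" "level K ?v ?a' = {p', q'}"
        using pair pq(1,2,5) pq'(1,2,5) by blast+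
    qed
    have "p' \<notin> level K ?v ?a" unfolding lev using pq pq' lq by auto
    then have ne: "?a' \<noteq> ?a" using pq' by auto
    have r0: "loop_row k 0 \<inter> level K ?v ?a = {p}" unfolding lev using pq by (auto simp: K_def)
    have rl: "loop_row k l \<inter> level K ?v ?a' = {p'}" unfolding lev using pq' by (auto simp: K_def)
    have rla: "loop_row k l \<inter> level K ?v ?a = {}" unfolding lev using pq lq by auto
    have sub: "{?a, ?a'} \<subseteq> ?V" using pq pq' by auto
    obtain S where S: "S \<subseteq> K" "card S = card ?V - card {?a, ?a'}" "determines_outside K ?v S {?a, ?a'}"
      using obtain_representatives[OF K(1) sub] by blast
    have "joint G r = joint H r" if H: "\<forall>i<4. H i \<in> loops b k"
      and sp: "sign_pattern K ?v = sign_pattern K (joint H)" and eq: "\<forall>s\<in>S. ?v s = joint H s" and r: "r \<in> K" for H r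
    proof -
      note out = determines_outsideD[OF S(3) sp eq]
      have agree_a': "?v s = joint H s" if s: "s \<in> K" "\<bar>?v s\<bar> = ?a'" for s
      proof (rule agree_on_row[OF rowG[OF lq(1)] row0[OF H lq(1)] rl[unfolded K_def] sp[unfolded K_def] _ s[unfolded K_def]])
        show "?v t = joint H t" if t: "t \<in> loop_row k l" "\<bar>?v t\<bar> \<noteq> ?a'" for t
        proof -
          have "t \<in> K" "\<bar>?v t\<bar> \<noteq> ?a" using t rla by (auto simp: K_def)
          then show ?thesis using out[of t] t by blast
        qed
      qed
      show ?thesis
      proof (cases "\<bar>?v r\<bar> = ?a")
        case False
        then show ?thesis using out[OF r] agree_a'[OF r] by blast
      next
        case True
        show ?thesis
        proof (rule agree_on_row[OF rowG row0[OF H] r0[unfolded K_def] sp[unfolded K_def] _ r[unfolded K_def] True])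
          show "?v t = joint H t" if t: "t \<in> loop_row k 0" "\<bar>?v t\<bar> \<noteq> ?a" for t
          proof -
            have "t \<in> K" using t by (auto simp: K_def)
            then show ?thesis using out[of t] agree_a'[of t] t by blast
          qed
        qed auto
      qed
    qed
    moreover have "card S \<le> 2 * k - 2" using S(2) 3 ne by simp
    ultimately show ?thesis using S(1) by blast
  qed
qed

lemma card_linked_loops:
  "card {G \<in> {..<4} \<rightarrow>\<^sub>E loops b k. linked k G} \<le> pattern_bound (4 * k) * (2 * b + 1) ^ (2 * k - 2)"
proof -
  let ?A = "{G \<in> {..<4} \<rightarrow>\<^sub>E loops b k. linked k G}" and ?K = "positions k"
  have K: "card ?K = 4 * k" by (simp add: card_cartesian_product)
  have loop: "G i \<in> loops b k" if "G \<in> ?A" "i < 4" for G i using that by auto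
  have "card ?A \<le> 2 ^ (card ?K * card ?K) * 2 ^ (card ?K * card ?K) * 2 ^ card ?K * (2 * b + 1) ^ (2 * k - 2)"
  proof (rule card_le_of_determined[where v = joint])
    show "\<bar>joint G r\<bar> \<le> int b" if "G \<in> ?A" "r \<in> ?K" for G r
      using that loops_nth_bound[OF loop[OF that(1)]] by (auto simp: joint_def)
    show "G = H" if G: "G \<in> ?A" and H: "H \<in> ?A" and eq: "\<And>r. r \<in> ?K \<Longrightarrow> joint G r = joint H r" for G H
    proof (rule PiE_ext[of _ "{..<4}" "\<lambda>_. loops b k"])
      fix i :: nat assume i: "i \<in> {..<4}"
      show "G i = H i"
      proof (rule nth_equalityI)
        show "length (G i) = length (H i)"
          using loops_length[OF loop[OF G]] loops_length[OF loop[OF H]] i by simp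
        show "G i ! r = H i ! r" if "r < length (G i)" for r
          using eq[of "(i, r)"] that loops_length[OF loop[OF G]] i by (simp add: joint_def)
      qed
    qed (use G H in auto)
    fix G assume G: "G \<in> ?A"
    have l: "linked k G" using G by simp
    have ex: "\<exists>S\<subseteq>?K. card S \<le> 2 * k - 2 \<and> (\<forall>H. (\<forall>i<4. H i \<in> loops b k) \<and>
       sign_pattern ?K (joint G) = sign_pattern ?K (joint H) \<and> (\<forall>s\<in>S. joint G s = joint H s)
       \<longrightarrow> (\<forall>r\<in>?K. joint G r = joint H r))"
      by (rule linked_loops_determined[OF loop[OF G] l])
    then show "\<exists>S\<subseteq>?K. card S \<le> 2 * k - 2 \<and> (\<forall>H\<in>?A.
       sign_pattern ?K (joint G) = sign_pattern ?K (joint H) \<and> (\<forall>s\<in>S. joint G s = joint H s)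
       \<longrightarrow> (\<forall>r\<in>?K. joint G r = joint H r))"
      using loop by (elim exE conjE, intro exI conjI ballI) blast+
  qed simp
  then show ?thesis by (simp add: pattern_bound_def K)
qed

section \<open>Expectations of words in the input variables\<close>

text \<open>
  The product is at most the power of the largest factor, and that power is one of the summands.
\<close>
lemma prod_list_le_sum_list_power:
  fixes zs :: "real list"
  assumes "\<And>z. z \<in> set zs \<Longrightarrow> 0 \<le> z" "zs \<noteq> []"
  shows "prod_list zs \<le> (\<Sum>z\<leftarrow>zs. z ^ length zs)"
proof -
  let ?m = "Max (set zs)"
  have m: "?m \<in> set zs" "\<And>z. z \<in> set zs \<Longrightarrow> z \<le> ?m" using assms(2) by auto
  have "prod_list ys \<le> ?m ^ length ys" if "set ys \<subseteq> set zs" for ys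
    using that
  proof (induction ys)
    case (Cons y ys)
    have "0 \<le> prod_list ys" using Cons.prems assms(1) by (intro prod_list_nonneg) auto
    then show ?case using Cons m assms(1) by (auto intro!: mult_mono)
  qed simp
  then have "prod_list zs \<le> ?m ^ length zs" by simp
  also have "\<dots> \<le> (\<Sum>z\<leftarrow>zs. z ^ length zs)"
    by (rule member_le_sum_list) (use m assms(1) in auto)
  finally show ?thesis .
qed

text \<open>
  The common features of the Hermitian and the symmetric case, which differ in the expectation of
  \<open>(a j)\<^sup>2\<close>.
\<close>
locale toeplitz_input = prob_space M for M :: "'a measure" +
  fixes a :: "int \<Rightarrow> 'a \<Rightarrow> complex"
  assumes measurable_a [measurable]: "\<And>j. a j \<in> borel_measurable M"
    and a_uminus: "\<And>j \<omega>. \<omega> \<in> space M \<Longrightarrow> a (- j) \<omega> = cnj (a j \<omega>)"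
    and indep: "indep_vars (\<lambda>_. borel) a {0..}"
    and mean_0: "\<And>j. (\<integral>\<omega>. a j \<omega> \<partial>M) = 0"
    and second_moment: "\<And>j. (\<integral>\<omega>. (cmod (a j \<omega>))\<^sup>2 \<partial>M) = 1"
    and moments: "\<And>k. \<exists>C. \<forall>j. (\<integral>\<^sup>+\<omega>. ennreal (cmod (a j \<omega>) ^ k) \<partial>M) \<le> ennreal C"
begin

definition word :: "int list \<Rightarrow> 'a \<Rightarrow> complex" where
  "word J \<omega> = (\<Prod>j\<leftarrow>J. a j \<omega>)"

lemma word_append: "word (I @ J) \<omega> = word I \<omega> * word J \<omega>"
  by (simp add: word_def)

lemma word_measurable [measurable]: "word J \<in> borel_measurable M"
  unfolding word_def by (induction J) auto

text \<open>
  Measurability with respect to the inputs with index in \<open>A\<close>, in the factored form that fits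
  independence of disjoint subfamilies. As \<open>a (- j)\<close> is the conjugate of \<open>a j\<close>, only indices
  \<open>j \<ge> 0\<close> are used.
\<close>
definition depends_on :: "int set \<Rightarrow> ('a \<Rightarrow> complex) \<Rightarrow> bool" where
  "depends_on A f \<longleftrightarrow> (\<exists>F\<in>borel_measurable (PiM A (\<lambda>_. borel)).
     \<forall>\<omega>\<in>space M. f \<omega> = F (restrict (\<lambda>j. a j \<omega>) A))"

lemma depends_on_const: "depends_on A (\<lambda>_. c)"
  unfolding depends_on_def by (rule bexI[of _ "\<lambda>_. c"]) auto

lemma depends_on_input:
  assumes "\<bar>j\<bar> \<in> A"
  shows "depends_on A (a j)"
proof (cases "j \<ge> 0")
  case True
  then show ?thesis using assms unfolding depends_on_def
    by (intro bexI[of _ "\<lambda>x. x j"]) auto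
next
  case False
  then have A: "- j \<in> A" using assms by simp
  have "a j \<omega> = cnj (a (- j) \<omega>)" if "\<omega> \<in> space M" for \<omega>
    using a_uminus[OF that, of "- j"] by simp
  moreover have "cnj \<in> borel_measurable borel"
    by (intro borel_measurable_continuous_onI continuous_intros)
  then have "(\<lambda>x. cnj (x (- j))) \<in> borel_measurable (PiM A (\<lambda>_. borel))"
    by (rule measurable_compose[rotated]) (use A in simp)
  ultimately show ?thesis using A unfolding depends_on_def
    by (intro bexI[of _ "\<lambda>x. cnj (x (- j))"]) auto
qed

lemma depends_on_mult:
  assumes "depends_on A f" "depends_on A g"
  shows "depends_on A (\<lambda>\<omega>. f \<omega> * g \<omega>)"
proof -
  obtain F G where [measurable]: "F \<in> borel_measurable (PiM A (\<lambda>_. borel))" "G \<in> borel_measurable (PiM A (\<lambda>_. borel))"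
    and "\<forall>\<omega>\<in>space M. f \<omega> = F (restrict (\<lambda>j. a j \<omega>) A)" "\<forall>\<omega>\<in>space M. g \<omega> = G (restrict (\<lambda>j. a j \<omega>) A)"
    using assms unfolding depends_on_def by blast
  then show ?thesis unfolding depends_on_def by (intro bexI[of _ "\<lambda>x. F x * G x"]) auto
qed

lemma depends_on_diff_const:
  assumes "depends_on A f"
  shows "depends_on A (\<lambda>\<omega>. f \<omega> - c)"
proof -
  obtain F where [measurable]: "F \<in> borel_measurable (PiM A (\<lambda>_. borel))"
    and "\<forall>\<omega>\<in>space M. f \<omega> = F (restrict (\<lambda>j. a j \<omega>) A)"
    using assms unfolding depends_on_def by blast
  then show ?thesis unfolding depends_on_def by (intro bexI[of _ "\<lambda>x. F x - c"]) auto
qed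

lemma depends_on_word:
  assumes "abs ` set J \<subseteq> A"
  shows "depends_on A (word J)"
  using assms
proof (induction J)
  case Nil
  then show ?case using depends_on_const[of A 1] by (simp add: word_def[abs_def])
next
  case (Cons j J)
  then show ?case using depends_on_mult[OF depends_on_input[of j A], of "word J"]
    by (simp add: word_def[abs_def])
qed

lemma depends_on_prod:
  assumes "finite L" "\<And>l. l \<in> L \<Longrightarrow> depends_on A (f l)"
  shows "depends_on A (\<lambda>\<omega>. \<Prod>l\<in>L. f l \<omega>)"
  using assms by (induction L) (simp_all add: depends_on_const depends_on_mult)

lemma expectation_mult_depends_on:
  assumes f: "depends_on A f" "integrable M f" and g: "depends_on B g" "integrable M g"
    and AB: "A \<inter> B = {}" "A \<subseteq> {0..}" "B \<subseteq> {0..}"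
  shows "(\<integral>\<omega>. f \<omega> * g \<omega> \<partial>M) = (\<integral>\<omega>. f \<omega> \<partial>M) * (\<integral>\<omega>. g \<omega> \<partial>M)"
proof -
  obtain F G where F: "F \<in> borel_measurable (PiM A (\<lambda>_. borel))" "\<forall>\<omega>\<in>space M. f \<omega> = F (restrict (\<lambda>j. a j \<omega>) A)"
    and G: "G \<in> borel_measurable (PiM B (\<lambda>_. borel))" "\<forall>\<omega>\<in>space M. g \<omega> = G (restrict (\<lambda>j. a j \<omega>) B)"
    using f(1) g(1) unfolding depends_on_def by blast
  let ?f = "F \<circ> (\<lambda>\<omega>. restrict (\<lambda>j. a j \<omega>) A)" and ?g = "G \<circ> (\<lambda>\<omega>. restrict (\<lambda>j. a j \<omega>) B)"
  have iv: "indep_var borel ?f borel ?g"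
    by (rule indep_var_compose[OF indep_var_restrict[OF indep AB] F(1) G(1)])
  have "integrable M ?f" "integrable M ?g"
    using f(2) g(2) F(2) G(2) by (auto simp: cong: Bochner_Integration.integrable_cong)
  then have "(\<integral>\<omega>. ?f \<omega> * ?g \<omega> \<partial>M) = (\<integral>\<omega>. ?f \<omega> \<partial>M) * (\<integral>\<omega>. ?g \<omega> \<partial>M)"
    by (rule indep_var_lebesgue_integral[OF iv])
  moreover have "(\<integral>\<omega>. ?f \<omega> * ?g \<omega> \<partial>M) = (\<integral>\<omega>. f \<omega> * g \<omega> \<partial>M)"
    "(\<integral>\<omega>. ?f \<omega> \<partial>M) = (\<integral>\<omega>. f \<omega> \<partial>M)" "(\<integral>\<omega>. ?g \<omega> \<partial>M) = (\<integral>\<omega>. g \<omega> \<partial>M)"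
    using F(2) G(2) by (auto intro!: Bochner_Integration.integral_cong)
  ultimately show ?thesis by simp
qed

lemma obtain_moment_bound:
  obtains C where "C \<ge> 0" "\<And>j. integrable M (\<lambda>\<omega>. cmod (a j \<omega>) ^ k)" "\<And>j. (\<integral>\<omega>. cmod (a j \<omega>) ^ k \<partial>M) \<le> C"
proof -
  obtain C0 where C0: "\<And>j. (\<integral>\<^sup>+\<omega>. ennreal (cmod (a j \<omega>) ^ k) \<partial>M) \<le> ennreal C0"
    using moments[of k] by blast
  have int: "integrable M (\<lambda>\<omega>. cmod (a j \<omega>) ^ k)" for j
  proof (rule integrableI_nonneg)
    show "(\<integral>\<^sup>+\<omega>. ennreal (cmod (a j \<omega>) ^ k) \<partial>M) < \<infinity>"
      using C0[of j] by (rule order_le_less_trans) simp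
  qed auto
  have "ennreal (\<integral>\<omega>. cmod (a j \<omega>) ^ k \<partial>M) \<le> ennreal (max C0 0)" for j
    using C0[of j] nn_integral_eq_integral[OF int[of j]] by (simp add: ennreal_max_0)
  then have "(\<integral>\<omega>. cmod (a j \<omega>) ^ k \<partial>M) \<le> max C0 0" for j
    using ennreal_le_iff by (metis max.cobounded2)
  then show ?thesis using that[of "max C0 0"] int by auto
qed

lemma norm_word: "cmod (word J \<omega>) = (\<Prod>j\<leftarrow>J. cmod (a j \<omega>))"
  by (induction J) (simp_all add: word_def norm_mult)

lemma obtain_word_bound:
  obtains B where "B \<ge> 0" "\<And>J. length J = k \<Longrightarrow> integrable M (\<lambda>\<omega>. cmod (word J \<omega>))"
    "\<And>J. length J = k \<Longrightarrow> (\<integral>\<omega>. cmod (word J \<omega>) \<partial>M) \<le> B"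
proof (cases "k = 0")
  case True
  show ?thesis by (rule that[of 1]) (auto simp: True word_def prob_space)
next
  case False
  obtain C where C: "C \<ge> 0" "\<And>j. integrable M (\<lambda>\<omega>. cmod (a j \<omega>) ^ k)" "\<And>j. (\<integral>\<omega>. cmod (a j \<omega>) ^ k \<partial>M) \<le> C"
    using obtain_moment_bound by blast
  have le: "cmod (word J \<omega>) \<le> (\<Sum>j\<leftarrow>J. cmod (a j \<omega>) ^ k)" if "length J = k" for J \<omega>
    using prod_list_le_sum_list_power[of "map (\<lambda>j. cmod (a j \<omega>)) J"] that False
    by (force simp: norm_word o_def)
  have int: "integrable M (\<lambda>\<omega>. \<Sum>j\<leftarrow>J. cmod (a j \<omega>) ^ k)"
    "(\<integral>\<omega>. (\<Sum>j\<leftarrow>J. cmod (a j \<omega>) ^ k) \<partial>M) \<le> real (length J) * C" for J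
  proof (induction J)
    case (Cons j J)
    { case 1 show ?case using Cons(1) C(2) by simp }
    { case 2 show ?case using Cons C(2) C(3)[of j] by (simp add: algebra_simps add_mono) }
  qed auto
  have iw: "integrable M (\<lambda>\<omega>. cmod (word J \<omega>))" if "length J = k" for J
    by (rule Bochner_Integration.integrable_bound[OF int(1)[of J]])
       (use le[OF that] in \<open>auto intro!: AE_I2 order_trans[OF _ abs_ge_self]\<close>)
  have "(\<integral>\<omega>. cmod (word J \<omega>) \<partial>M) \<le> real k * C" if "length J = k" for J
    using integral_mono[OF iw[OF that] int(1)[of J] le[OF that]] int(2)[of J] that by simp
  then show ?thesis using that[of "real k * C"] iw C(1) by auto
qed

text \<open>
  Chosen once for each length, so that estimates can refer to it without existential quantifiers.
\<close>
definition word_bound :: "nat \<Rightarrow> real" where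
  "word_bound k = (SOME B. B \<ge> 0 \<and> (\<forall>J. length J = k \<longrightarrow> (\<integral>\<omega>. cmod (word J \<omega>) \<partial>M) \<le> B))"

lemma word_bound: "word_bound k \<ge> 0" "length J = k \<Longrightarrow> (\<integral>\<omega>. cmod (word J \<omega>) \<partial>M) \<le> word_bound k"
proof -
  have "\<exists>B. B \<ge> 0 \<and> (\<forall>J. length J = k \<longrightarrow> (\<integral>\<omega>. cmod (word J \<omega>) \<partial>M) \<le> B)"
    using obtain_word_bound[of k] by metis
  from someI_ex[OF this] show "word_bound k \<ge> 0" "length J = k \<Longrightarrow> (\<integral>\<omega>. cmod (word J \<omega>) \<partial>M) \<le> word_bound k"
    unfolding word_bound_def by auto
qed

lemma integrable_norm_word: "integrable M (\<lambda>\<omega>. cmod (word J \<omega>))"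
  using obtain_word_bound[of "length J"] by metis

lemma integrable_word: "integrable M (word J)"
  using integrable_norm_word[of J] by (simp add: integrable_norm_iff)

definition mean_word :: "int list \<Rightarrow> complex" where
  "mean_word J = (\<integral>\<omega>. word J \<omega> \<partial>M)"

lemma norm_mean_word_le: "length J = k \<Longrightarrow> cmod (mean_word J) \<le> word_bound k"
  unfolding mean_word_def by (rule order_trans[OF integral_norm_bound word_bound(2)])

text \<open>A modulus that occurs only once splits off an independent factor of mean zero.\<close>
lemma unmatched_split:
  assumes "r < length J" "\<And>s. s < length J \<Longrightarrow> s \<noteq> r \<Longrightarrow> \<bar>J ! s\<bar> \<noteq> \<bar>J ! r\<bar>"
  obtains I where "\<And>\<omega>. word J \<omega> = a (J ! r) \<omega> * word I \<omega>" "\<bar>J ! r\<bar> \<notin> abs ` set I" "set I \<subseteq> set J"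
proof
  let ?I = "take r J @ drop (Suc r) J"
  show "word J \<omega> = a (J ! r) \<omega> * word ?I \<omega>" for \<omega>
    using id_take_nth_drop[OF assms(1)]
    by (metis (no_types, lifting) mult.left_commute word_append list.simps(9) prod_list.Cons word_def)
  show "set ?I \<subseteq> set J" using set_take_subset[of r J] set_drop_subset[of "Suc r" J] by auto
  show "\<bar>J ! r\<bar> \<notin> abs ` set ?I"
  proof
    assume "\<bar>J ! r\<bar> \<in> abs ` set ?I"
    then obtain x where x: "x \<in> set (take r J) \<union> set (drop (Suc r) J)" "\<bar>J ! r\<bar> = \<bar>x\<bar>" by auto
    from x(1) have "\<exists>s<length J. s \<noteq> r \<and> x = J ! s"
    proof
      assume "x \<in> set (take r J)"
      then obtain s where "s < length (take r J)" "x = take r J ! s" by (metis in_set_conv_nth)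
      then show ?thesis by (intro exI[of _ s]) auto
    next
      assume "x \<in> set (drop (Suc r) J)"
      then obtain s where "s < length (drop (Suc r) J)" "x = drop (Suc r) J ! s" by (metis in_set_conv_nth)
      then show ?thesis by (intro exI[of _ "Suc r + s"]) auto
    qed
    then show False using assms(2) x(2) by metis
  qed
qed

lemma mean_word_unmatched:
  assumes "\<not> matched_list J"
  shows "mean_word J = 0"
proof -
  obtain r where r: "r < length J" "\<And>s. s < length J \<Longrightarrow> s \<noteq> r \<Longrightarrow> \<bar>J ! s\<bar> \<noteq> \<bar>J ! r\<bar>"
    using assms unfolding matched_def by auto
  obtain I where I: "\<And>\<omega>. word J \<omega> = a (J ! r) \<omega> * word I \<omega>" "\<bar>J ! r\<bar> \<notin> abs ` set I"
    using unmatched_split[OF r] by metis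
  have "integrable M (a (J ! r))" using integrable_word[of "[J ! r]"] by (simp add: word_def[abs_def])
  then have "mean_word J = (\<integral>\<omega>. a (J ! r) \<omega> \<partial>M) * (\<integral>\<omega>. word I \<omega> \<partial>M)"
    unfolding mean_word_def I(1)
    by (intro expectation_mult_depends_on[OF depends_on_input[of "J ! r" "{\<bar>J ! r\<bar>}"] _
          depends_on_word[of I "abs ` set I"] integrable_word])
       (use I(2) in auto)
  then show ?thesis by (simp add: mean_0)
qed

text \<open>
  The word is the product of the independent variables \<open>\<bar>a x\<bar>\<^sup>2\<close> over its positive letters \<open>x\<close>.
\<close>
lemma mean_word_opposite_paired:
  assumes "opposite_paired J"
  shows "mean_word J = 1"
proof -
  define B where "B = {x \<in> set J. 0 < x}"
  have B: "set J = B \<union> uminus ` B" "finite B" "B \<subseteq> {0..}"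
    using opposite_paired_set(1)[OF assms] by (auto simp: B_def)
  have disj: "B \<inter> uminus ` B = {}" by (auto simp: B_def)
  have "word J \<omega> = (\<Prod>x\<in>B. complex_of_real ((cmod (a x \<omega>))\<^sup>2))" if "\<omega> \<in> space M" for \<omega>
  proof -
    have "word J \<omega> = (\<Prod>x\<in>set J. a x \<omega>)"
      using assms by (simp add: word_def opposite_paired_def prod.distinct_set_conv_list)
    also have "\<dots> = (\<Prod>x\<in>B. a x \<omega>) * (\<Prod>x\<in>uminus ` B. a x \<omega>)"
      unfolding B(1) by (rule prod.union_disjoint) (use B disj in auto)
    also have "(\<Prod>x\<in>uminus ` B. a x \<omega>) = (\<Prod>x\<in>B. cnj (a x \<omega>))"
      using a_uminus[OF that] by (subst prod.reindex) auto
    finally show ?thesis by (simp only: prod.distrib complex_norm_square)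
  qed
  then have "mean_word J = (\<integral>\<omega>. (\<Prod>x\<in>B. complex_of_real ((cmod (a x \<omega>))\<^sup>2)) \<partial>M)"
    unfolding mean_word_def by (rule Bochner_Integration.integral_cong[OF refl])
  also have "\<dots> = (\<Prod>x\<in>B. \<integral>\<omega>. complex_of_real ((cmod (a x \<omega>))\<^sup>2) \<partial>M)"
  proof (rule indep_vars_lebesgue_integral[OF B(2)])
    show "indep_vars (\<lambda>_. borel) (\<lambda>x \<omega>. complex_of_real ((cmod (a x \<omega>))\<^sup>2)) B"
      by (rule indep_vars_compose2[OF indep_vars_subset[OF indep B(3)]]) auto
    show "integrable M (\<lambda>\<omega>. complex_of_real ((cmod (a x \<omega>))\<^sup>2))" for x
      using obtain_moment_bound[of 2] by (metis integrable_of_real)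
  qed
  also have "\<dots> = 1" by (simp add: second_moment flip: of_real_power)
  finally show ?thesis .
qed

definition centred :: "int list \<Rightarrow> 'a \<Rightarrow> complex" where
  "centred J \<omega> = word J \<omega> - mean_word J"

lemma centred_measurable [measurable]: "centred J \<in> borel_measurable M"
  unfolding centred_def[abs_def] by measurable

lemma power4_add_le: "(x + y) ^ 4 \<le> 16 * (x ^ 4 + y ^ 4)" if "0 \<le> x" "0 \<le> (y::real)"
proof -
  have "(x + y) ^ 4 \<le> (2 * max x y) ^ 4" using that by (intro power_mono) auto
  also have "\<dots> = 16 * (max x y) ^ 4" by (simp add: power_mult_distrib)
  also have "(max x y) ^ 4 \<le> x ^ 4 + y ^ 4" using that by (auto simp: max_def)
  finally show ?thesis by simp
qed

text \<open>
  A bound that is linear in norms of words, so that it can be integrated; the fourth power of a word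
  is again a word.
\<close>
lemma prod_centred_bound:
  assumes L: "L \<subseteq> {..<4::nat}"
  shows "cmod (\<Prod>i\<in>L. centred (G i) \<omega>)
     \<le> (\<Sum>i<4. 1 + 16 * (cmod (word (G i @ G i @ G i @ G i) \<omega>) + word_bound (length (G i)) ^ 4))"
proof -
  define z where "z i = max 1 (cmod (centred (G i) \<omega>))" for i
  have z1: "1 \<le> z i" for i by (simp add: z_def)
  then have z0: "0 \<le> z i" for i by (meson order_trans zero_le_one)
  have fin: "finite L" using L finite_subset by auto
  have "cmod (\<Prod>i\<in>L. centred (G i) \<omega>) \<le> (\<Prod>i\<in>L. z i)"
    unfolding prod_norm[symmetric] by (intro prod_mono) (simp add: z_def)
  also have "\<dots> \<le> (\<Prod>i<4. z i)"
    by (rule prod_mono2) (use L z0 z1 in auto)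
  also have "\<dots> = prod_list (map z [0..<4])"
    by (simp add: prod.list_conv_set_nth lessThan_atLeast0)
  also have "\<dots> \<le> (\<Sum>x\<leftarrow>map z [0..<4]. x ^ length (map z [0..<4]))"
    by (rule prod_list_le_sum_list_power) (use z0 in auto)
  also have "\<dots> = (\<Sum>i<4. z i ^ 4)"
    by (simp add: interv_sum_list_conv_sum_set_nat lessThan_atLeast0 o_def)
  also have "\<dots> \<le> (\<Sum>i<4. 1 + 16 * (cmod (word (G i @ G i @ G i @ G i) \<omega>) + word_bound (length (G i)) ^ 4))"
  proof (rule sum_mono)
    fix i :: nat assume "i \<in> {..<4}"
    have "z i ^ 4 \<le> 1 + cmod (centred (G i) \<omega>) ^ 4" by (auto simp: z_def max_def)
    also have "\<dots> \<le> 1 + (cmod (word (G i) \<omega>) + word_bound (length (G i))) ^ 4"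
      unfolding centred_def using norm_mean_word_le[OF refl, of "G i"]
      by (intro add_left_mono power_mono order_trans[OF norm_triangle_ineq4] add_left_mono) auto
    also have "\<dots> \<le> 1 + 16 * (cmod (word (G i) \<omega>) ^ 4 + word_bound (length (G i)) ^ 4)"
      by (intro add_left_mono power4_add_le) (auto simp: word_bound(1))
    also have "cmod (word (G i) \<omega>) ^ 4 = cmod (word (G i @ G i @ G i @ G i) \<omega>)"
      by (simp add: word_append norm_mult power4_eq_xxxx)
    finally show "z i ^ 4 \<le> 1 + 16 * (cmod (word (G i @ G i @ G i @ G i) \<omega>) + word_bound (length (G i)) ^ 4)" .
  qed
  finally show ?thesis .
qed

definition quadruple_bound :: "nat \<Rightarrow> real" where
  "quadruple_bound k = 4 * (1 + 16 * (word_bound (4 * k) + word_bound k ^ 4))"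

lemma integrable_prod_centred:
  assumes L: "L \<subseteq> {..<4::nat}"
  shows "integrable M (\<lambda>\<omega>. \<Prod>i\<in>L. centred (G i) \<omega>)"
proof (rule Bochner_Integration.integrable_bound)
  let ?h = "\<lambda>\<omega>. \<Sum>i<4::nat. 1 + 16 * (cmod (word (G i @ G i @ G i @ G i) \<omega>) + word_bound (length (G i)) ^ 4)"
  show "integrable M ?h" by (intro Bochner_Integration.integrable_sum Bochner_Integration.integrable_add integrable_mult_right integrable_norm_word) simp_all
  show "AE \<omega> in M. cmod (\<Prod>i\<in>L. centred (G i) \<omega>) \<le> norm (?h \<omega>)"
    by (intro AE_I2 order_trans[OF prod_centred_bound[OF L]]) (simp only: real_norm_def abs_ge_self)
qed measurable

lemma norm_expectation_prod_centred_le: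
  fixes G :: "nat \<Rightarrow> int list"
  assumes G: "\<And>i. i < 4 \<Longrightarrow> length (G i) = k"
  shows "cmod (\<integral>\<omega>. (\<Prod>i<4. centred (G i) \<omega>) \<partial>M) \<le> quadruple_bound k"
proof -
  let ?h = "\<lambda>\<omega>. \<Sum>i<4::nat. 1 + 16 * (cmod (word (G i @ G i @ G i @ G i) \<omega>) + word_bound (length (G i)) ^ 4)"
  have h: "integrable M ?h" by (intro Bochner_Integration.integrable_sum Bochner_Integration.integrable_add integrable_mult_right integrable_norm_word) simp_all
  have "cmod (\<integral>\<omega>. (\<Prod>i<4. centred (G i) \<omega>) \<partial>M) \<le> (\<integral>\<omega>. cmod (\<Prod>i<4. centred (G i) \<omega>) \<partial>M)"
    by (rule integral_norm_bound)
  also have "\<dots> \<le> (\<integral>\<omega>. ?h \<omega> \<partial>M)"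
    by (rule integral_mono[OF integrable_norm[OF integrable_prod_centred] h prod_centred_bound]) auto
  also have "\<dots> = (\<Sum>i<4. 1 + 16 * ((\<integral>\<omega>. cmod (word (G i @ G i @ G i @ G i) \<omega>) \<partial>M) + word_bound (length (G i)) ^ 4))"
  proof -
    have "integrable M (\<lambda>\<omega>. 1 + 16 * (cmod (word (G i @ G i @ G i @ G i) \<omega>) + word_bound (length (G i)) ^ 4))" for i
      by (intro Bochner_Integration.integrable_add integrable_mult_right integrable_norm_word) simp_all
    moreover have "(\<integral>\<omega>. 1 + 16 * (cmod (word I \<omega>) + c) \<partial>M) = 1 + 16 * ((\<integral>\<omega>. cmod (word I \<omega>) \<partial>M) + c)" for I c
      using integrable_norm_word[of I] by (simp add: prob_space)
    ultimately show ?thesis by (subst Bochner_Integration.integral_sum) simp_all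
  qed
  also have "\<dots> \<le> (\<Sum>i<4::nat. 1 + 16 * (word_bound (4 * k) + word_bound k ^ 4))"
  proof (rule sum_mono)
    fix i :: nat assume "i \<in> {..<4}"
    then show "1 + 16 * ((\<integral>\<omega>. cmod (word (G i @ G i @ G i @ G i) \<omega>) \<partial>M) + word_bound (length (G i)) ^ 4)
        \<le> 1 + 16 * (word_bound (4 * k) + word_bound k ^ 4)"
      using word_bound(2)[of "G i @ G i @ G i @ G i" "4 * k"] G[of i] by simp
  qed
  finally show ?thesis by (simp add: quadruple_bound_def)
qed

lemma expectation_centred: "(\<integral>\<omega>. centred J \<omega> \<partial>M) = 0"
  unfolding centred_def using integrable_word[of J] by (simp add: mean_word_def prob_space)

lemma depends_on_prod_centred:
  assumes "finite L" "\<And>i. i \<in> L \<Longrightarrow> abs ` set (G i) \<subseteq> A"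
  shows "depends_on A (\<lambda>\<omega>. \<Prod>i\<in>L. centred (G i) \<omega>)"
  unfolding centred_def using assms by (intro depends_on_prod depends_on_diff_const depends_on_word) auto

text \<open>
  If a loop shares no modulus with the other three, its centred word is an independent factor of mean
  zero. If a modulus occurs only once in the quadruple, the corresponding input is such a factor; in
  this case the word containing it is already centred.
\<close>
lemma expectation_prod_centred_unlinked:
  assumes G: "\<And>i. i < 4 \<Longrightarrow> length (G i) = k" and unl: "\<not> linked k G"
  shows "(\<integral>\<omega>. (\<Prod>i<4. centred (G i) \<omega>) \<partial>M) = 0"
proof -
  have split: "(\<Prod>i<4. centred (G i) \<omega>) = centred (G i) \<omega> * (\<Prod>l\<in>{..<4} - {i}. centred (G l) \<omega>)"
    if "i < 4" for i \<omega> using that by (subst prod.remove[of _ i]) auto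
  have moduli: "\<exists>s<k. y = \<bar>G l ! s\<bar>" if "y \<in> abs ` set (G l)" "l < 4" for y l
    using that G[of l] by (auto simp: in_set_conv_nth)
  show ?thesis
  proof (cases "matched (positions k) (joint G)")
    case True
    with unl obtain i where i: "i < 4"
      "\<And>r i' r'. r < k \<Longrightarrow> i' < 4 \<Longrightarrow> r' < k \<Longrightarrow> i' \<noteq> i \<Longrightarrow> \<bar>G i' ! r'\<bar> \<noteq> \<bar>G i ! r\<bar>"
      unfolding linked_def by blast
    let ?A = "abs ` set (G i)" and ?B = "\<Union>l\<in>{..<4} - {i}. abs ` set (G l)"
    have "(\<integral>\<omega>. (\<Prod>i<4. centred (G i) \<omega>) \<partial>M)
        = (\<integral>\<omega>. centred (G i) \<omega> \<partial>M) * (\<integral>\<omega>. (\<Prod>l\<in>{..<4} - {i}. centred (G l) \<omega>) \<partial>M)"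
      unfolding split[OF i(1)]
    proof (rule expectation_mult_depends_on)
      show "depends_on ?A (centred (G i))" "integrable M (centred (G i))"
        using depends_on_prod_centred[of "{i}" G ?A] integrable_prod_centred[of "{i}" G] i(1) by auto
      show "depends_on ?B (\<lambda>\<omega>. \<Prod>l\<in>{..<4} - {i}. centred (G l) \<omega>)"
        by (rule depends_on_prod_centred) auto
      show "integrable M (\<lambda>\<omega>. \<Prod>l\<in>{..<4} - {i}. centred (G l) \<omega>)"
        by (rule integrable_prod_centred) auto
      show "?A \<inter> ?B = {}"
      proof (rule ccontr)
        assume "?A \<inter> ?B \<noteq> {}"
        then obtain y l where "y \<in> ?A" "l < 4" "l \<noteq> i" "y \<in> abs ` set (G l)" by auto
        then show False using moduli[of y i] moduli[of y l] i by metis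
      qed
    qed auto
    then show ?thesis by (simp add: expectation_centred)
  next
    case False
    then obtain p where p: "p \<in> positions k" "\<And>q. q \<in> positions k \<Longrightarrow> q \<noteq> p \<Longrightarrow> \<bar>joint G q\<bar> \<noteq> \<bar>joint G p\<bar>"
      unfolding matched_def by blast
    obtain i r where ir: "p = (i, r)" "i < 4" "r < k" using p(1) by auto
    have uniq: "\<bar>G l ! s\<bar> \<noteq> \<bar>G i ! r\<bar>" if "l < 4" "s < k" "(l, s) \<noteq> (i, r)" for l s
      using p(2)[of "(l, s)"] that ir(1) by (simp add: joint_def)
    have r: "r < length (G i)" "\<And>s. s < length (G i) \<Longrightarrow> s \<noteq> r \<Longrightarrow> \<bar>G i ! s\<bar> \<noteq> \<bar>G i ! r\<bar>"
      using ir uniq[of i] G[of i] by auto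
    obtain I where I: "\<And>\<omega>. word (G i) \<omega> = a (G i ! r) \<omega> * word I \<omega>" "\<bar>G i ! r\<bar> \<notin> abs ` set I"
      using unmatched_split[OF r] by metis
    have mw: "mean_word (G i) = 0"
      by (rule mean_word_unmatched) (use r in \<open>auto simp: matched_def\<close>)
    let ?R = "\<lambda>\<omega>. \<Prod>l\<in>{..<4} - {i}. centred (G l) \<omega>"
    let ?B = "abs ` set I \<union> (\<Union>l\<in>{..<4} - {i}. abs ` set (G l))"
    have "(\<integral>\<omega>. (\<Prod>i<4. centred (G i) \<omega>) \<partial>M) = (\<integral>\<omega>. a (G i ! r) \<omega> * (word I \<omega> * ?R \<omega>) \<partial>M)"
      unfolding split[OF ir(2)] centred_def[of "G i"] mw I(1) by (simp add: mult.assoc)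
    also have "\<dots> = (\<integral>\<omega>. a (G i ! r) \<omega> \<partial>M) * (\<integral>\<omega>. word I \<omega> * ?R \<omega> \<partial>M)"
    proof (rule expectation_mult_depends_on)
      show "depends_on {\<bar>G i ! r\<bar>} (a (G i ! r))" by (rule depends_on_input) simp
      show "integrable M (a (G i ! r))" using integrable_word[of "[G i ! r]"] by (simp add: word_def[abs_def])
      show "depends_on ?B (\<lambda>\<omega>. word I \<omega> * ?R \<omega>)"
        by (intro depends_on_mult depends_on_word depends_on_prod_centred) auto
      have eq: "word I \<omega> * ?R \<omega> = (\<Prod>l<4. centred ((G(i := I)) l) \<omega>) + mean_word I * ?R \<omega>" for \<omega>
      proof -
        have "(\<Prod>l<4. centred ((G(i := I)) l) \<omega>) = centred I \<omega> * ?R \<omega>"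
          using ir(2) by (subst prod.remove[of _ i]) (auto intro!: prod.cong)
        then show ?thesis by (simp add: centred_def[of I] algebra_simps)
      qed
      show "integrable M (\<lambda>\<omega>. word I \<omega> * ?R \<omega>)"
        unfolding eq by (intro Bochner_Integration.integrable_add integrable_mult_right integrable_prod_centred) auto
      have "\<bar>G i ! r\<bar> \<notin> abs ` set (G l)" if "l < 4" "l \<noteq> i" for l
        using moduli[of "\<bar>G i ! r\<bar>" l] that uniq[of l] by (metis prod.inject)
      then show "{\<bar>G i ! r\<bar>} \<inter> ?B = {}" using I(2) by auto
    qed auto
    finally show ?thesis by (simp add: mean_0)
  qed
qed

end

section \<open>Limits and fluctuations of the moments\<close>

lemma binomial_over_power_tendsto:
  "(\<lambda>b::nat. real (b choose p) / real b ^ p) \<longlonglongrightarrow> 1 / fact p"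
proof -
  have "(\<lambda>b::nat. (\<Prod>i = 0..<p. 1 - real i / real b) / fact p) \<longlonglongrightarrow> (\<Prod>i = 0..<p. 1 - 0) / fact p"
    by (intro tendsto_intros lim_const_over_n) auto
  moreover have "\<forall>\<^sub>F b in sequentially. (\<Prod>i = 0..<p. 1 - real i / real b) / fact p = real (b choose p) / real b ^ p"
    using eventually_gt_at_top[of 0]
  proof eventually_elim
    case (elim b)
    have "real (b choose p) = (\<Prod>i = 0..<p. real b - real i) / fact p"
      by (simp add: binomial_gbinomial gbinomial_prod_rev)
    also have "(\<Prod>i = 0..<p. real b - real i) = (\<Prod>i = 0..<p. real b * (1 - real i / real b))"
      using elim by (intro prod.cong refl) (simp add: field_simps)
    also have "\<dots> = real b ^ p * (\<Prod>i = 0..<p. 1 - real i / real b)"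
      by (simp add: prod.distrib)
    finally show ?case using elim by simp
  qed
  ultimately show ?thesis by (simp add: Lim_transform_eventually)
qed

abbreviation "opposite_loops b k \<equiv> {J \<in> loops b k. opposite_paired J}"
abbreviation "exceptional_loops b k \<equiv> {J \<in> loops b k. matched_list J \<and> \<not> opposite_paired J}"

lemma inverse_sqrt_power_even: "(1 / sqrt (2 * real b)) ^ (2 * p) = 1 / (2 * real b) ^ p"
  by (simp add: power_mult power_divide)

text \<open>The Gaussian moments arise as \<open>(2 p)! (b choose p) / (2 b)\<^sup>p \<longlonglongrightarrow> (2 p)! / (2\<^sup>p p!)\<close>.\<close>
lemma opposite_loops_tendsto:
  "(\<lambda>b. (1 / sqrt (2 * real b)) ^ k * real (card (opposite_loops b k))) \<longlonglongrightarrow> normal_moment k"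
proof (cases "even k")
  case True
  then obtain p where k: "k = 2 * p" by (auto elim: evenE)
  have "(\<lambda>b::nat. fact (2 * p) / 2 ^ p * (real (b choose p) / real b ^ p)) \<longlonglongrightarrow> fact (2 * p) / 2 ^ p * (1 / fact p)"
    by (intro tendsto_intros binomial_over_power_tendsto)
  then show ?thesis
    unfolding k card_opposite_paired_even inverse_sqrt_power_even normal_moment_even
    by (simp add: power_mult_distrib mult_ac)
next
  case False
  then have empty: "opposite_loops b k = {}" for b using not_opposite_paired_odd by blast
  show ?thesis unfolding empty using False by (simp add: normal_moment_odd)
qed

text \<open>
  For \<open>k > 0\<close> there are \<open>O(b\<^sup>h)\<close> exceptional loops with \<open>2 * h + 1 \<le> k\<close>, and so at least one factor
  \<open>1 / sqrt (2 * b)\<close> is left over.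
\<close>
lemma exceptional_loops_tendsto:
  "(\<lambda>b. (1 / sqrt (2 * real b)) ^ k * real (card (exceptional_loops b k))) \<longlonglongrightarrow> 0"
proof (cases "k = 0")
  case True
  have empty: "exceptional_loops b 0 = {}" for b
    by (auto simp: loops_def steps_def opposite_paired_def)
  show ?thesis unfolding True empty by simp
next
  case False
  define h where "h = (k - 1) div 2"
  have kh: "2 * h + 1 \<le> k" using False by (simp add: h_def)
  define C where "C = real (pattern_bound k) * 2 ^ h"
  have lim: "(\<lambda>b::nat. C * (1 / sqrt (2 * real b))) \<longlonglongrightarrow> 0"
    by real_asymp
  show ?thesis
  proof (rule real_tendsto_sandwich[OF _ _ tendsto_const lim])
    show "\<forall>\<^sub>F b in sequentially. (1 / sqrt (2 * real b)) ^ k * real (card (exceptional_loops b k)) \<le> C * (1 / sqrt (2 * real b))"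
      using eventually_ge_at_top[of 1]
    proof eventually_elim
      case (elim b)
      let ?s = "1 / sqrt (2 * real b)"
      have s: "0 \<le> ?s" "?s \<le> 1" using elim by auto
      have "?s ^ k \<le> ?s ^ (2 * h + 1)" by (rule power_decreasing[OF kh s])
      also have "\<dots> = 1 / (2 * real b) ^ h * ?s"
        using inverse_sqrt_power_even[of b h] by simp
      finally have 1: "?s ^ k \<le> 1 / (2 * real b) ^ h * ?s" .
      have "real (card (exceptional_loops b k)) \<le> real (pattern_bound k * (2 * b + 1) ^ h)"
        using card_matched_not_opposite_paired[of b k] unfolding h_def by (rule of_nat_mono)
      also have "\<dots> = real (pattern_bound k) * (2 * real b + 1) ^ h" by (simp add: add.commute)
      also have "\<dots> \<le> real (pattern_bound k) * (2 * (2 * real b)) ^ h"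
        using elim by (intro mult_left_mono power_mono) auto
      finally have "?s ^ k * real (card (exceptional_loops b k))
          \<le> (1 / (2 * real b) ^ h * ?s) * (real (pattern_bound k) * (2 * (2 * real b)) ^ h)"
        using 1 s by (intro mult_mono) auto
      also have "\<dots> = C * ?s * ((2 * real b) ^ h / (2 * real b) ^ h)"
        unfolding C_def power_mult_distrib[of 2 "2 * real b" h] by (simp add: mult_ac)
      also have "\<dots> = C * ?s" using elim by simp
      finally show ?case .
    qed
  qed auto
qed

context toeplitz_input begin

definition moment :: "nat \<Rightarrow> nat \<Rightarrow> nat \<Rightarrow> 'a \<Rightarrow> complex" where
  "moment N b k \<omega> = complex_of_real (1 / sqrt (2 * real b)) ^ k
     * (\<Sum>J\<in>loops b k. of_real (weight N J) * word J \<omega>)"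

lemma moment_measurable [measurable]: "moment N b k \<in> borel_measurable M"
  unfolding moment_def[abs_def] by measurable

lemma integrable_moment: "integrable M (moment N b k)"
  unfolding moment_def[abs_def] by (intro integrable_mult_right Bochner_Integration.integrable_sum integrable_word)

lemma moment_eq:
  assumes "\<omega> \<in> space M" "N > 0"
  shows "of_real (\<integral>x. x ^ k \<partial>eigenvalue_distribution (normalized_band_toeplitz N b (\<lambda>j. a j \<omega>))) = moment N b k \<omega>"
  unfolding moment_def word_def
  by (rule moment_normalized_band_toeplitz[OF assms(2)]) (rule a_uminus[OF assms(1)])

lemma expectation_moment:
  "(\<integral>\<omega>. moment N b k \<omega> \<partial>M) = complex_of_real (1 / sqrt (2 * real b)) ^ k
     * (\<Sum>J\<in>loops b k. of_real (weight N J) * mean_word J)"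
  unfolding moment_def mean_word_def
  by (subst integral_mult_right_zero, subst Bochner_Integration.integral_sum) (auto intro: integrable_word)

text \<open>
  The first error term comes from matched loops that are not opposite-paired, the second from walks
  that leave the matrix.
\<close>
lemma expectation_moment_error:
  fixes N b k :: nat
  assumes "N > 0"
  defines "s \<equiv> (1 / sqrt (2 * real b)) ^ k"
  shows "cmod ((\<integral>\<omega>. moment N b k \<omega> \<partial>M) - of_real (s * real (card (opposite_loops b k))))
    \<le> s * real (card (exceptional_loops b k)) * word_bound k
      + s * real (card (opposite_loops b k)) * (2 * real k * (real b / real N))"
proof -
  let ?O = "opposite_loops b k" and ?E = "exceptional_loops b k"
  let ?f = "\<lambda>J. of_real (weight N J) * mean_word J"
  have s0: "0 \<le> s" by (simp add: s_def)
  have "(\<Sum>J\<in>loops b k. ?f J) = (\<Sum>J\<in>?O \<union> ?E. ?f J)"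
    by (rule sum.mono_neutral_right) (auto intro!: mean_word_unmatched)
  also have "\<dots> = (\<Sum>J\<in>?O. ?f J) + (\<Sum>J\<in>?E. ?f J)"
    by (rule sum.union_disjoint) auto
  finally have "(\<Sum>J\<in>loops b k. ?f J) - of_real (real (card ?O))
      = (\<Sum>J\<in>?O. of_real (weight N J) - 1) + (\<Sum>J\<in>?E. ?f J)"
    by (simp add: sum_subtractf mean_word_opposite_paired)
  also have "cmod \<dots> \<le> (\<Sum>J\<in>?O. 2 * real k * (real b / real N)) + (\<Sum>J\<in>?E. word_bound k)"
  proof (intro norm_triangle_le add_mono sum_norm_le)
    fix J assume "J \<in> ?O"
    then have "J \<in> steps b k" by (simp add: loops_def)
    then have "1 - weight N J \<le> 2 * real k * (real b / real N)" "weight N J \<le> 1"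
      using weight_bounds(2)[OF assms(1)] weight_bounds(3)[OF assms(1)] by auto
    moreover have "cmod (of_real (weight N J) - 1) = \<bar>weight N J - 1\<bar>"
      by (metis norm_of_real of_real_1 of_real_diff)
    ultimately show "cmod (of_real (weight N J) - 1) \<le> 2 * real k * (real b / real N)" by linarith
  next
    fix J assume "J \<in> ?E"
    then have "cmod (mean_word J) \<le> word_bound k" using loops_length norm_mean_word_le by blast
    moreover have "0 \<le> weight N J" "weight N J \<le> 1" using weight_bounds[OF assms(1)] by auto
    ultimately show "cmod (?f J) \<le> word_bound k"
      using mult_mono[of "weight N J" 1 "cmod (mean_word J)" "word_bound k"] by (simp add: norm_mult)
  qed
  finally have le: "cmod ((\<Sum>J\<in>loops b k. ?f J) - of_real (real (card ?O)))
      \<le> real (card ?O) * (2 * real k * (real b / real N)) + real (card ?E) * word_bound k" by simp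
  have "(\<integral>\<omega>. moment N b k \<omega> \<partial>M) - of_real (s * real (card ?O))
      = of_real s * ((\<Sum>J\<in>loops b k. ?f J) - of_real (real (card ?O)))"
    unfolding expectation_moment by (simp add: s_def right_diff_distrib)
  then have "cmod ((\<integral>\<omega>. moment N b k \<omega> \<partial>M) - of_real (s * real (card ?O)))
      = s * cmod ((\<Sum>J\<in>loops b k. ?f J) - of_real (real (card ?O)))"
    using s0 by (simp only: norm_mult norm_of_real abs_of_nonneg)
  also have "\<dots> \<le> s * (real (card ?O) * (2 * real k * (real b / real N)) + real (card ?E) * word_bound k)"
    by (rule mult_left_mono[OF le s0])
  finally show ?thesis by (simp add: algebra_simps)
qed

lemma expectation_moment_tendsto:
  assumes b: "filterlim b at_top sequentially" "(\<lambda>N. real (b N) / real N) \<longlonglongrightarrow> 0"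
  shows "(\<lambda>N. \<integral>\<omega>. moment N (b N) k \<omega> \<partial>M) \<longlonglongrightarrow> complex_of_real (normal_moment k)"
proof -
  define S where "S N = (1 / sqrt (2 * real (b N))) ^ k * real (card (opposite_loops (b N) k))" for N
  define T where "T N = (1 / sqrt (2 * real (b N))) ^ k * real (card (exceptional_loops (b N) k))" for N
  have S: "S \<longlonglongrightarrow> normal_moment k" unfolding S_def
    using filterlim_compose[OF opposite_loops_tendsto b(1)] .
  have T: "T \<longlonglongrightarrow> 0" unfolding T_def
    using filterlim_compose[OF exceptional_loops_tendsto b(1)] .
  have "(\<lambda>N. T N * word_bound k + S N * (2 * real k * (real (b N) / real N))) \<longlonglongrightarrow>
      0 * word_bound k + normal_moment k * (2 * real k * 0)"
    by (intro tendsto_intros S T b(2))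
  then have "(\<lambda>N. T N * word_bound k + S N * (2 * real k * (real (b N) / real N))) \<longlonglongrightarrow> 0" by simp
  moreover have "\<forall>\<^sub>F N in sequentially. cmod ((\<integral>\<omega>. moment N (b N) k \<omega> \<partial>M) - of_real (S N))
      \<le> T N * word_bound k + S N * (2 * real k * (real (b N) / real N))"
    using eventually_gt_at_top[of 0]
  proof eventually_elim
    case (elim N)
    then show ?case unfolding S_def T_def by (rule expectation_moment_error)
  qed
  ultimately have "(\<lambda>N. (\<integral>\<omega>. moment N (b N) k \<omega> \<partial>M) - of_real (S N)) \<longlonglongrightarrow> 0"
    by (rule Lim_null_comparison[rotated])
  from tendsto_add[OF this tendsto_of_real[OF S]] show ?thesis by simp
qed

text \<open>
  Moments of Hermitian matrices are real; the real version is the one whose deviation from its mean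
  has nonnegative even powers.
\<close>
definition real_moment :: "nat \<Rightarrow> nat \<Rightarrow> nat \<Rightarrow> 'a \<Rightarrow> real" where
  "real_moment N b k \<omega> = Re (moment N b k \<omega>)"

lemma of_real_real_moment:
  assumes "\<omega> \<in> space M" "N > 0"
  shows "complex_of_real (real_moment N b k \<omega>) = moment N b k \<omega>"
  unfolding real_moment_def moment_eq[OF assms, symmetric] by simp

lemma real_moment_eq:
  assumes "\<omega> \<in> space M" "N > 0"
  shows "real_moment N b k \<omega> = (\<integral>x. x ^ k \<partial>eigenvalue_distribution (normalized_band_toeplitz N b (\<lambda>j. a j \<omega>)))"
  unfolding real_moment_def moment_eq[OF assms, symmetric] by simp

lemma real_moment_measurable [measurable]: "real_moment N b k \<in> borel_measurable M"
  unfolding real_moment_def[abs_def] by measurable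

lemma integrable_real_moment: "integrable M (real_moment N b k)"
  unfolding real_moment_def[abs_def] by (intro integrable_Re integrable_moment)

lemma expectation_real_moment:
  assumes "N > 0"
  shows "complex_of_real (\<integral>\<omega>. real_moment N b k \<omega> \<partial>M) = (\<integral>\<omega>. moment N b k \<omega> \<partial>M)"
proof -
  have "(\<integral>\<omega>. moment N b k \<omega> \<partial>M) = (\<integral>\<omega>. complex_of_real (real_moment N b k \<omega>) \<partial>M)"
    by (rule Bochner_Integration.integral_cong[OF refl]) (simp add: of_real_real_moment assms)
  then show ?thesis by simp
qed

lemma expectation_real_moment_tendsto:
  assumes "filterlim b at_top sequentially" "(\<lambda>N. real (b N) / real N) \<longlonglongrightarrow> 0"
  shows "(\<lambda>N. \<integral>\<omega>. real_moment N (b N) k \<omega> \<partial>M) \<longlonglongrightarrow> normal_moment k"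
proof -
  have "(\<lambda>N. Re (\<integral>\<omega>. moment N (b N) k \<omega> \<partial>M)) \<longlonglongrightarrow> Re (complex_of_real (normal_moment k))"
    by (intro tendsto_Re expectation_moment_tendsto assms)
  moreover have "(\<integral>\<omega>. real_moment N (b N) k \<omega> \<partial>M) = Re (\<integral>\<omega>. moment N (b N) k \<omega> \<partial>M)" for N
    unfolding real_moment_def by (rule integral_Re[OF integrable_moment])
  ultimately show ?thesis by simp
qed

text \<open>
  The fourth power of the deviation expands into quadruples of loops, and only linked quadruples
  have a nonzero expectation.
\<close>
lemma deviation_power4:
  assumes "\<omega> \<in> space M" "N > 0"
  shows "complex_of_real ((real_moment N b k \<omega> - (\<integral>\<omega>. real_moment N b k \<omega> \<partial>M)) ^ 4)
    = of_real ((1 / sqrt (2 * real b)) ^ (4 * k)) * (\<Sum>G\<in>{..<4::nat} \<rightarrow>\<^sub>E loops b k.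
        of_real (\<Prod>i<4. weight N (G i)) * (\<Prod>i<4. centred (G i) \<omega>))"
proof -
  define s where "s = complex_of_real (1 / sqrt (2 * real b))"
  define S where "S = (\<Sum>J\<in>loops b k. of_real (weight N J) * centred J \<omega>)"
  have "complex_of_real (real_moment N b k \<omega> - (\<integral>\<omega>. real_moment N b k \<omega> \<partial>M))
      = moment N b k \<omega> - (\<integral>\<omega>. moment N b k \<omega> \<partial>M)"
    by (simp only: of_real_diff of_real_real_moment[OF assms] expectation_real_moment[OF assms(2)])
  also have "\<dots> = s ^ k * S"
    unfolding moment_def[of N b k \<omega>] expectation_moment s_def S_def centred_def
    by (simp only: right_diff_distrib[symmetric] sum_subtractf[symmetric])
  finally have "complex_of_real ((real_moment N b k \<omega> - (\<integral>\<omega>. real_moment N b k \<omega> \<partial>M)) ^ 4) = (s ^ k * S) ^ 4"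
    by (simp only: of_real_power)
  also have "\<dots> = s ^ (4 * k) * (\<Prod>i<4::nat. S)"
    by (simp add: power_mult_distrib power_mult[symmetric] mult.commute)
  also have "(\<Prod>i<4::nat. S) = (\<Sum>G\<in>{..<4::nat} \<rightarrow>\<^sub>E loops b k. \<Prod>i<4. of_real (weight N (G i)) * centred (G i) \<omega>)"
    unfolding S_def by (rule prod_sum_PiE) auto
  also have "\<dots> = (\<Sum>G\<in>{..<4::nat} \<rightarrow>\<^sub>E loops b k. of_real (\<Prod>i<4. weight N (G i)) * (\<Prod>i<4. centred (G i) \<omega>))"
    by (simp add: prod.distrib)
  finally show ?thesis by (simp add: s_def)
qed

lemma quadruple_bound_nonneg: "0 \<le> quadruple_bound k"
  using word_bound(1) unfolding quadruple_bound_def by simp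

definition fluctuation_bound :: "nat \<Rightarrow> real" where
  "fluctuation_bound k = real (pattern_bound (4 * k)) * 2 ^ (2 * k) * quadruple_bound k"

lemma
  assumes N: "N > 0" and b: "b > 0"
  shows integrable_deviation_power4:
      "integrable M (\<lambda>\<omega>. (real_moment N b k \<omega> - (\<integral>\<omega>. real_moment N b k \<omega> \<partial>M)) ^ 4)"
    and expectation_deviation_power4_le:
      "(\<integral>\<omega>. (real_moment N b k \<omega> - (\<integral>\<omega>. real_moment N b k \<omega> \<partial>M)) ^ 4 \<partial>M) \<le> fluctuation_bound k / (real b)\<^sup>2"
proof -
  let ?D = "\<lambda>\<omega>. (real_moment N b k \<omega> - (\<integral>\<omega>. real_moment N b k \<omega> \<partial>M)) ^ 4"
  let ?Q = "{..<4::nat} \<rightarrow>\<^sub>E loops b k"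
  let ?t = "(1 / sqrt (2 * real b)) ^ (4 * k)"
  let ?w = "\<lambda>G. \<Prod>i<4::nat. weight N (G i)"
  let ?L = "{G \<in> ?Q. linked k G}"
  have finQ: "finite ?Q" by (rule finite_PiE) auto
  have len: "length (G i) = k" if "G \<in> ?Q" "i < 4" for G i
    using that loops_length[of "G i" b k] by auto
  have intG: "integrable M (\<lambda>\<omega>. of_real (?w G) * (\<Prod>i<4::nat. centred (G i) \<omega>))" for G
    by (intro integrable_mult_right integrable_prod_centred) auto
  have intD: "integrable M (\<lambda>\<omega>. complex_of_real (?D \<omega>))"
    by (subst Bochner_Integration.integrable_cong[OF refl deviation_power4[OF _ N]], assumption)
       (intro integrable_mult_right Bochner_Integration.integrable_sum intG)
  then show int: "integrable M ?D" by (simp only: complex_of_real_integrable_eq)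
  have t: "?t = 1 / (2 * real b) ^ (2 * k)"
    using inverse_sqrt_power_even[of b "2 * k"] by simp
  have w: "cmod (of_real (?w G)) \<le> 1" for G
  proof -
    have "0 \<le> ?w G" "?w G \<le> 1"
      using weight_bounds[OF N] by (auto intro!: prod_nonneg prod_le_1)
    then show ?thesis by (simp only: norm_of_real abs_of_nonneg)
  qed
  have "complex_of_real (\<integral>\<omega>. ?D \<omega> \<partial>M) = (\<integral>\<omega>. complex_of_real (?D \<omega>) \<partial>M)"
    by (rule integral_complex_of_real[symmetric])
  also have "\<dots> = (\<integral>\<omega>. of_real ?t * (\<Sum>G\<in>?Q. of_real (?w G) * (\<Prod>i<4. centred (G i) \<omega>)) \<partial>M)"
    by (rule Bochner_Integration.integral_cong[OF refl]) (rule deviation_power4[OF _ N])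
  also have "\<dots> = of_real ?t * (\<Sum>G\<in>?Q. of_real (?w G) * (\<integral>\<omega>. (\<Prod>i<4. centred (G i) \<omega>) \<partial>M))"
    by (simp only: integral_mult_right_zero Bochner_Integration.integral_sum[OF intG])
  also have "(\<Sum>G\<in>?Q. of_real (?w G) * (\<integral>\<omega>. (\<Prod>i<4. centred (G i) \<omega>) \<partial>M))
      = (\<Sum>G\<in>?L. of_real (?w G) * (\<integral>\<omega>. (\<Prod>i<4. centred (G i) \<omega>) \<partial>M))"
    using finQ len by (intro sum.mono_neutral_right) (auto intro!: expectation_prod_centred_unlinked)
  finally have eq: "complex_of_real (\<integral>\<omega>. ?D \<omega> \<partial>M) = of_real ?t * (\<Sum>G\<in>?L. of_real (?w G) * (\<integral>\<omega>. (\<Prod>i<4. centred (G i) \<omega>) \<partial>M))" .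
  have sumle: "cmod (\<Sum>G\<in>?L. of_real (?w G) * (\<integral>\<omega>. (\<Prod>i<4. centred (G i) \<omega>) \<partial>M)) \<le> (\<Sum>G\<in>?L. 1 * quadruple_bound k)"
    by (rule sum_norm_le, unfold norm_mult, rule mult_mono)
       (use w len in \<open>auto intro!: norm_expectation_prod_centred_le\<close>)
  have "(\<integral>\<omega>. ?D \<omega> \<partial>M) \<le> cmod (complex_of_real (\<integral>\<omega>. ?D \<omega> \<partial>M))" by simp
  also have "\<dots> \<le> ?t * (\<Sum>G\<in>?L. 1 * quadruple_bound k)"
    unfolding eq norm_mult norm_of_real using mult_left_mono[OF sumle, of ?t] by simp
  also have "\<dots> = ?t * real (card ?L) * quadruple_bound k" by simp
  finally have le: "(\<integral>\<omega>. ?D \<omega> \<partial>M) \<le> ?t * real (card ?L) * quadruple_bound k" .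
  have "?t * real (card ?L) \<le> real (pattern_bound (4 * k)) * 2 ^ (2 * k) / (real b)\<^sup>2"
  proof (cases "k = 0")
    case True
    then have "\<not> linked k G" for G by (auto simp: linked_def intro!: exI[of _ 0])
    then have "?L = {}" by blast
    then show ?thesis by (simp only:) simp
  next
    case False
    then have k: "2 * k = 2 * k - 2 + 2" by simp
    have "real (card ?L) \<le> real (pattern_bound (4 * k) * (2 * b + 1) ^ (2 * k - 2))"
      by (rule of_nat_mono[OF card_linked_loops])
    also have "\<dots> = real (pattern_bound (4 * k)) * (2 * real b + 1) ^ (2 * k - 2)" by (simp add: add.commute)
    also have "\<dots> \<le> real (pattern_bound (4 * k)) * (2 * (2 * real b)) ^ (2 * k - 2)"
      using b by (intro mult_left_mono power_mono) auto
    finally have "?t * real (card ?L)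
        \<le> 1 / (2 * real b) ^ (2 * k) * (real (pattern_bound (4 * k)) * (2 * (2 * real b)) ^ (2 * k - 2))"
      unfolding t by (rule mult_left_mono) simp
    also have "\<dots> = real (pattern_bound (4 * k)) * 2 ^ (2 * k - 2) / (2 * real b)\<^sup>2"
    proof -
      have "(2 * real b) ^ (2 * k) = (2 * real b) ^ (2 * k - 2) * (2 * real b)\<^sup>2"
        by (subst k) (simp only: power_add)
      moreover have "1 / (A * B) * (P * (q * A)) = P * q / B" if "A \<noteq> 0" for A B P q :: real
        using that by simp
      ultimately show ?thesis using b by (simp only: power_mult_distrib[of 2 "2 * real b"]) simp
    qed
    also have "\<dots> \<le> real (pattern_bound (4 * k)) * 2 ^ (2 * k) / (real b)\<^sup>2"
      using b by (intro frac_le mult_left_mono power_increasing power_mono) auto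
    finally show ?thesis .
  qed
  then have "?t * real (card ?L) * quadruple_bound k \<le> fluctuation_bound k / (real b)\<^sup>2"
    using mult_right_mono[OF _ quadruple_bound_nonneg[of k]] unfolding fluctuation_bound_def by fastforce
  with le show "(\<integral>\<omega>. ?D \<omega> \<partial>M) \<le> fluctuation_bound k / (real b)\<^sup>2" by linarith
qed

text \<open>
  By monotone convergence the sum of the functions has finite integral, and hence is finite almost
  everywhere.
\<close>
lemma AE_tendsto_0_of_summable:
  fixes f :: "nat \<Rightarrow> 'a \<Rightarrow> real"
  assumes [measurable]: "\<And>n. f n \<in> borel_measurable M" and nn: "\<And>n \<omega>. 0 \<le> f n \<omega>"
    and int: "\<And>n. integrable M (f n)" and summ: "summable (\<lambda>n. \<integral>\<omega>. f n \<omega> \<partial>M)"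
  shows "AE \<omega> in M. (\<lambda>n. f n \<omega>) \<longlonglongrightarrow> 0"
proof -
  have "(\<integral>\<^sup>+\<omega>. (\<Sum>n. ennreal (f n \<omega>)) \<partial>M) = (\<Sum>n. \<integral>\<^sup>+\<omega>. ennreal (f n \<omega>) \<partial>M)"
    by (rule nn_integral_suminf) measurable
  also have "\<dots> = (\<Sum>n. ennreal (\<integral>\<omega>. f n \<omega> \<partial>M))"
    using nn by (simp add: nn_integral_eq_integral[OF int])
  also have "\<dots> \<noteq> \<infinity>"
    using summ nn by (simp add: suminf_ennreal2)
  finally have "AE \<omega> in M. (\<Sum>n. ennreal (f n \<omega>)) \<noteq> \<infinity>"
    by (intro nn_integral_noteq_infinite) auto
  then show ?thesis
  proof eventually_elim
    case (elim \<omega>)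
    then have "summable (\<lambda>n. f n \<omega>)" using nn by (intro summable_suminf_not_top) auto
    then show ?case by (rule summable_LIMSEQ_zero)
  qed
qed

text \<open>
  The expectations converge, and the deviations from them tend to zero since their fourth moments
  are summable.
\<close>
lemma AE_real_moment_tendsto:
  assumes b: "filterlim b at_top sequentially" "(\<lambda>N. real (b N) / real N) \<longlonglongrightarrow> 0"
    and summ: "summable (\<lambda>N. 1 / (real (b N))\<^sup>2)"
  shows "AE \<omega> in M. (\<lambda>N. real_moment N (b N) k \<omega>) \<longlonglongrightarrow> normal_moment k"
proof -
  let ?m = "\<lambda>N. \<integral>\<omega>. real_moment N (b N) k \<omega> \<partial>M"
  have "\<forall>\<^sub>F N in sequentially. b N > 0 \<and> N > 0"
    by (intro eventually_conj eventually_gt_at_top eventually_compose_filterlim[OF eventually_gt_at_top b(1)])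
  then obtain n where n: "\<And>N. N \<ge> n \<Longrightarrow> b N > 0 \<and> N > 0" by (auto simp: eventually_sequentially)
  define f where "f N \<omega> = (real_moment (N + n) (b (N + n)) k \<omega> - ?m (N + n)) ^ 4" for N \<omega>
  have "AE \<omega> in M. (\<lambda>N. f N \<omega>) \<longlonglongrightarrow> 0"
  proof (rule AE_tendsto_0_of_summable)
    show "f N \<in> borel_measurable M" for N unfolding f_def by measurable
    show "0 \<le> f N \<omega>" for N \<omega> by (simp add: f_def)
    show "integrable M (f N)" for N unfolding f_def
      by (rule integrable_deviation_power4) (use n[of "N + n"] in auto)
    have "summable (\<lambda>N. fluctuation_bound k * (1 / (real (b (N + n)))\<^sup>2))"
      by (intro summable_mult) (use summ summable_iff_shift[of "\<lambda>N. 1 / (real (b N))\<^sup>2" n] in simp)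
    then show "summable (\<lambda>N. \<integral>\<omega>. f N \<omega> \<partial>M)"
    proof (rule summable_comparison_test'[of _ 0])
      fix N
      have "(\<integral>\<omega>. f N \<omega> \<partial>M) \<le> fluctuation_bound k / (real (b (N + n)))\<^sup>2"
        unfolding f_def by (rule expectation_deviation_power4_le) (use n[of "N + n"] in auto)
      moreover have "0 \<le> (\<integral>\<omega>. f N \<omega> \<partial>M)" by (rule integral_nonneg_AE) (simp add: f_def)
      ultimately show "norm (\<integral>\<omega>. f N \<omega> \<partial>M) \<le> fluctuation_bound k * (1 / (real (b (N + n)))\<^sup>2)" by simp
    qed
  qed
  then show ?thesis
  proof eventually_elim
    case (elim \<omega>)
    have "(\<lambda>N. root 4 (f N \<omega>)) \<longlonglongrightarrow> root 4 0" by (rule tendsto_real_root[OF elim])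
    moreover have "root 4 (f N \<omega>) = \<bar>real_moment (N + n) (b (N + n)) k \<omega> - ?m (N + n)\<bar>" for N
      using real_root_power_cancel[of 4 "\<bar>real_moment (N + n) (b (N + n)) k \<omega> - ?m (N + n)\<bar>"]
      by (simp add: f_def power_even_abs)
    ultimately have "(\<lambda>N. real_moment (N + n) (b (N + n)) k \<omega> - ?m (N + n)) \<longlonglongrightarrow> 0"
      by (simp add: tendsto_rabs_zero_iff)
    then have "(\<lambda>N. real_moment N (b N) k \<omega> - ?m N) \<longlonglongrightarrow> 0" by (rule LIMSEQ_offset)
    from tendsto_add[OF this expectation_real_moment_tendsto[OF b, of k]] show ?case by simp
  qed
qed

end

section \<open>Hermitian and symmetric inputs\<close>

text \<open>
  The symmetry relations between the inputs hold on the space of \<open>M\<close> only, not for all \<open>\<omega>\<close>.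
\<close>
lemma (in prob_space) indep_vars_cong_space:
  assumes "indep_vars N X I" "\<And>i \<omega>. i \<in> I \<Longrightarrow> \<omega> \<in> space M \<Longrightarrow> X i \<omega> = Y i \<omega>"
  shows "indep_vars N Y I"
proof -
  have "X i -` A \<inter> space M = Y i -` A \<inter> space M" if "i \<in> I" for i A
    using assms(2)[OF that] by auto
  then have "indep_sets (\<lambda>i. {X i -` A \<inter> space M |A. A \<in> sets (N i)}) I
      \<longleftrightarrow> indep_sets (\<lambda>i. {Y i -` A \<inter> space M |A. A \<in> sets (N i)}) I"
    by (intro indep_sets_cong refl) simp
  moreover have "random_variable (N i) (X i) \<longleftrightarrow> random_variable (N i) (Y i)" if "i \<in> I" for i
    by (rule measurable_cong) (rule assms(2)[OF that])
  ultimately show ?thesis using assms(1) unfolding indep_vars_def2 by blast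
qed

lemma exists_ennreal_bound_of_SUP:
  assumes "(SUP j\<in>A. f j) < (\<infinity>::ennreal)"
  shows "\<exists>C. \<forall>j\<in>A. f j \<le> ennreal C"
proof -
  obtain C where "(SUP j\<in>A. f j) = ennreal C" using assms by (cases "SUP j\<in>A. f j") auto
  then show ?thesis by (metis SUP_upper)
qed

text \<open>
  In the Hermitian case the pair of real and imaginary part is regrouped into one complex variable
  for each \<open>j \<ge> 0\<close>.
\<close>
lemma toeplitz_input_of_hermitian:
  assumes "prob_space M" and h: "hermitian_input M a"
  shows "toeplitz_input M a"
proof -
  interpret prob_space M by fact
  have meas [measurable]: "a j \<in> borel_measurable M" for j using h by (simp add: hermitian_input_def)
  have real0: "a 0 \<omega> \<in> \<real>" if "\<omega> \<in> space M" for \<omega> using h that by (simp add: hermitian_input_def)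
  have sym: "Re (a j \<omega>) = Re (a (- j) \<omega>)" "Im (a j \<omega>) = - Im (a (- j) \<omega>)" if "j \<ge> 1" "\<omega> \<in> space M" for j \<omega>
    using h that unfolding hermitian_input_def by blast+
  show ?thesis
  proof
    show "a j \<in> borel_measurable M" for j by (rule meas)
    show "a (- j) \<omega> = cnj (a j \<omega>)" if w: "\<omega> \<in> space M" for j \<omega>
    proof -
      consider "j = 0" | "j \<ge> 1" | "- j \<ge> 1" by linarith
      then show ?thesis
      proof cases
        case 1
        then show ?thesis using real0[OF w] by (simp add: Reals_cnj_iff)
      next
        case 2
        then show ?thesis using sym[OF 2 w] by (intro complex_eqI) auto
      next
        case 3
        then show ?thesis using sym[OF 3 w] by (intro complex_eqI) auto
      qed
    qed
    define Z where "Z = case_sum (\<lambda>j \<omega>. Re (a j \<omega>)) (\<lambda>j \<omega>. Im (a j \<omega>))"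
    define K where "K j = (if j = 0 then {Inl 0} else {Inl j, Inr j})" for j :: int
    define Y where "Y j x = (if j = 0 then complex_of_real (x (Inl 0)) else Complex (x (Inl j)) (x (Inr j)))"
      for j :: int and x :: "int + int \<Rightarrow> real"
    have "indep_vars (\<lambda>j. PiM (K j) (\<lambda>_. borel)) (\<lambda>j \<omega>. restrict (\<lambda>i. Z i \<omega>) (K j)) {0..}"
    proof (rule indep_vars_restrict)
      show "indep_vars (\<lambda>_. borel) Z ({0..} <+> {1..})"
        using h by (simp add: hermitian_input_def Z_def)
      show "K j \<subseteq> {0..} <+> {1..}" if "j \<in> {0..}" for j using that by (auto simp: K_def)
      show "disjoint_family_on K {0..}" by (auto simp: disjoint_family_on_def K_def)
    qed
    then have "indep_vars (\<lambda>_. borel) (\<lambda>j \<omega>. Y j (restrict (\<lambda>i. Z i \<omega>) (K j))) {0..}"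
    proof (rule indep_vars_compose2)
      fix j :: int
      show "Y j \<in> borel_measurable (PiM (K j) (\<lambda>_. borel))"
      proof (cases "j = 0")
        case True
        have "(\<lambda>x. complex_of_real (x (Inl 0))) \<in> borel_measurable (PiM {Inl 0 :: int + int} (\<lambda>_. borel))"
          by measurable
        then show ?thesis using True by (simp add: Y_def[abs_def] K_def)
      next
        case False
        have "(\<lambda>x. complex_of_real (x (Inl j)) + \<i> * complex_of_real (x (Inr j)))
            \<in> borel_measurable (PiM {Inl j, Inr j} (\<lambda>_. borel))"
          by measurable
        then show ?thesis using False by (simp add: Y_def[abs_def] K_def Complex_eq)
      qed
    qed
    then show "indep_vars (\<lambda>_. borel) a {0..}"
    proof (rule indep_vars_cong_space)
      show "Y j (restrict (\<lambda>i. Z i \<omega>) (K j)) = a j \<omega>" if "\<omega> \<in> space M" for j \<omega>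
        using real0[OF that] by (auto simp: Y_def K_def Z_def)
    qed
    show "(\<integral>\<omega>. a j \<omega> \<partial>M) = 0" "(\<integral>\<omega>. (cmod (a j \<omega>))\<^sup>2 \<partial>M) = 1" for j
      using h by (auto simp: hermitian_input_def)
    show "\<exists>C. \<forall>j. (\<integral>\<^sup>+\<omega>. ennreal (cmod (a j \<omega>) ^ k) \<partial>M) \<le> ennreal C" for k
      using exists_ennreal_bound_of_SUP[of "\<lambda>j. \<integral>\<^sup>+\<omega>. ennreal (cmod (a j \<omega>) ^ k) \<partial>M" UNIV] h
      unfolding hermitian_input_def by blast
  qed
qed

text \<open>
  Negative indices reduce to positive ones, and conjugation is trivial on real variables.
\<close>
lemma toeplitz_input_of_symmetric:
  assumes "prob_space M" and h: "symmetric_input M a"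
  shows "toeplitz_input M a"
proof -
  interpret prob_space M by fact
  have meas [measurable]: "a j \<in> borel_measurable M" for j using h by (simp add: symmetric_input_def)
  have real: "a j \<omega> \<in> \<real>" if "\<omega> \<in> space M" for j \<omega> using h that by (simp add: symmetric_input_def)
  have sym: "a (- j) \<omega> = a j \<omega>" if w: "\<omega> \<in> space M" for j \<omega>
  proof (cases "j \<ge> 0")
    case True
    then show ?thesis using h w unfolding symmetric_input_def by metis
  next
    case False
    then have "- j \<ge> 0" by simp
    then have "a (- j) \<omega> = a (- (- j)) \<omega>" using h w unfolding symmetric_input_def by blast
    then show ?thesis by simp
  qed
  have abs: "a \<bar>j\<bar> \<omega> = a j \<omega>" if "\<omega> \<in> space M" for j \<omega>
    using sym[OF that, of j] by (cases "j \<ge> 0") auto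
  show ?thesis
  proof
    show "a j \<in> borel_measurable M" for j by (rule meas)
    show "a (- j) \<omega> = cnj (a j \<omega>)" if w: "\<omega> \<in> space M" for j \<omega>
      using sym[OF w] real[OF w, of j] by (simp add: Reals_cnj_iff)
    have "indep_vars (\<lambda>_. borel) (\<lambda>j \<omega>. Re (a j \<omega>)) {0..}"
      using h by (simp add: symmetric_input_def)
    then have "indep_vars (\<lambda>_. borel) (\<lambda>j \<omega>. complex_of_real (Re (a j \<omega>))) {0..}"
      by (rule indep_vars_compose2) measurable
    then show "indep_vars (\<lambda>_. borel) a {0..}"
      by (rule indep_vars_cong_space) (simp add: real of_real_Re)
    show "(\<integral>\<omega>. a j \<omega> \<partial>M) = 0" for j
    proof -
      have "(\<integral>\<omega>. a j \<omega> \<partial>M) = (\<integral>\<omega>. a \<bar>j\<bar> \<omega> \<partial>M)"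
        by (rule Bochner_Integration.integral_cong[OF refl]) (simp add: abs)
      then show ?thesis using h by (simp add: symmetric_input_def)
    qed
    show "(\<integral>\<omega>. (cmod (a j \<omega>))\<^sup>2 \<partial>M) = 1" for j
    proof -
      have "(\<integral>\<omega>. (cmod (a j \<omega>))\<^sup>2 \<partial>M) = (\<integral>\<omega>. (cmod (a \<bar>j\<bar> \<omega>))\<^sup>2 \<partial>M)"
        by (rule Bochner_Integration.integral_cong[OF refl]) (simp add: abs)
      then show ?thesis using h by (simp add: symmetric_input_def)
    qed
    show "\<exists>C. \<forall>j. (\<integral>\<^sup>+\<omega>. ennreal (cmod (a j \<omega>) ^ k) \<partial>M) \<le> ennreal C" for k
    proof -
      obtain C where C: "\<forall>j\<in>{0..}. (\<integral>\<^sup>+\<omega>. ennreal (cmod (a j \<omega>) ^ k) \<partial>M) \<le> ennreal C"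
        using exists_ennreal_bound_of_SUP[of "\<lambda>j. \<integral>\<^sup>+\<omega>. ennreal (cmod (a j \<omega>) ^ k) \<partial>M" "{0..}"] h
        unfolding symmetric_input_def by blast
      have "(\<integral>\<^sup>+\<omega>. ennreal (cmod (a j \<omega>) ^ k) \<partial>M) = (\<integral>\<^sup>+\<omega>. ennreal (cmod (a \<bar>j\<bar> \<omega>) ^ k) \<partial>M)" for j
        by (rule nn_integral_cong) (simp add: abs)
      then show ?thesis using C by (metis abs_ge_zero atLeast_iff)
    qed
  qed
qed

section \<open>The mean eigenvalue distribution and weak convergence\<close>

lemma tendsto_sum_mset:
  fixes f :: "nat \<Rightarrow> 'b \<Rightarrow> real"
  assumes "\<And>x. x \<in># S \<Longrightarrow> (\<lambda>n. f n x) \<longlonglongrightarrow> g x"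
  shows "(\<lambda>n. \<Sum>x\<in>#S. f n x) \<longlonglongrightarrow> (\<Sum>x\<in>#S. g x)"
  using assms by (induction S) (auto intro!: tendsto_add)

lemma integral_eigenvalue_distribution_tendsto:
  fixes f :: "nat \<Rightarrow> real \<Rightarrow> real"
  assumes A: "A \<in> carrier_mat n n" "n > 0"
    and [measurable]: "\<And>m. f m \<in> borel_measurable borel" "g \<in> borel_measurable borel"
    and lim: "\<And>x. (\<lambda>m. f m x) \<longlonglongrightarrow> g x"
  shows "(\<lambda>m. \<integral>x. f m x \<partial>eigenvalue_distribution A) \<longlonglongrightarrow> (\<integral>x. g x \<partial>eigenvalue_distribution A)"
  unfolding integral_eigenvalue_distribution(1)[OF A assms(3)] integral_eigenvalue_distribution(1)[OF A assms(4)]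
  by (intro tendsto_intros tendsto_sum_mset lim) (use A(2) in auto)

text \<open>
  Weierstrass approximation on \<open>[-n, n]\<close> with error below \<open>1 / (n + 1)\<close>.
\<close>
lemma continuous_polynomial_approximation:
  fixes f :: "real \<Rightarrow> real"
  assumes "continuous_on UNIV f"
  obtains p where "\<And>n. real_polynomial_function (p n)" "\<And>x. (\<lambda>n. p n x) \<longlonglongrightarrow> f x"
proof -
  have "\<exists>p. real_polynomial_function p \<and> (\<forall>x\<in>{- real n..real n}. \<bar>f x - p x\<bar> < 1 / real (Suc n))" for n
  proof -
    have "continuous_on {- real n..real n} f" using assms continuous_on_subset by blast
    then show ?thesis
      using Stone_Weierstrass_real_polynomial_function[of "{- real n..real n}" f "1 / real (Suc n)"] by (metis compact_Icc of_nat_0_less_iff zero_less_Suc zero_less_divide_1_iff)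
  qed
  then obtain p where p: "\<And>n. real_polynomial_function (p n)"
    "\<And>n x. x \<in> {- real n..real n} \<Longrightarrow> \<bar>f x - p n x\<bar> < 1 / real (Suc n)" by metis
  have "(\<lambda>n. p n x) \<longlonglongrightarrow> f x" for x
  proof -
    have "(\<lambda>n. 1 / real (Suc n)) \<longlonglongrightarrow> 0" by real_asymp
    moreover have "\<forall>\<^sub>F n in sequentially. norm (p n x - f x) \<le> 1 / real (Suc n)"
      using eventually_ge_at_top[of "nat \<lceil>\<bar>x\<bar>\<rceil>"]
    proof eventually_elim
      case (elim n)
      then have "x \<in> {- real n..real n}" by (auto simp: nat_ceiling_le_eq abs_le_iff)
      from p(2)[OF this] show ?case by (simp add: abs_minus_commute)
    qed
    ultimately have "(\<lambda>n. p n x - f x) \<longlonglongrightarrow> 0" by (rule Lim_null_comparison[rotated])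
    then show ?thesis by (rule LIM_zero_cancel)
  qed
  then show ?thesis using that p(1) by blast
qed

lemma Re_Im_char:
  assumes "real_distribution \<mu>"
  shows "Re (char \<mu> t) = (\<integral>x. cos (t * x) \<partial>\<mu>)" "Im (char \<mu> t) = (\<integral>x. sin (t * x) \<partial>\<mu>)"
proof -
  interpret real_distribution \<mu> by fact
  have i: "integrable \<mu> (\<lambda>x. iexp (t * x))" by (rule integrable_iexp) auto
  show "Re (char \<mu> t) = (\<integral>x. cos (t * x) \<partial>\<mu>)" "Im (char \<mu> t) = (\<integral>x. sin (t * x) \<partial>\<mu>)"
    unfolding char_def using integral_Re[OF i] integral_Im[OF i] by (simp_all add: Re_exp Im_exp)
qed

context toeplitz_input begin

definition spectrum_law :: "nat \<Rightarrow> nat \<Rightarrow> 'a \<Rightarrow> real measure" where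
  "spectrum_law N b \<omega> = eigenvalue_distribution (normalized_band_toeplitz N b (\<lambda>j. a j \<omega>))"

lemma real_distribution_spectrum_law: "real_distribution (spectrum_law N b \<omega>)"
  unfolding spectrum_law_def by (rule real_distribution_eigenvalue_distribution)

lemma prob_space_spectrum_law: "prob_space (spectrum_law N b \<omega>)"
  using real_distribution_spectrum_law by (rule real_distribution.axioms(1))

lemma sets_spectrum_law [simp]: "sets (spectrum_law N b \<omega>) = sets borel"
  and space_spectrum_law [simp]: "space (spectrum_law N b \<omega>) = UNIV"
  by (simp_all add: spectrum_law_def eigenvalue_distribution_def)

lemma integrable_spectrum_law:
  fixes f :: "real \<Rightarrow> real"
  assumes "N > 0" "f \<in> borel_measurable borel"
  shows "integrable (spectrum_law N b \<omega>) f"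
  unfolding spectrum_law_def by (rule integral_eigenvalue_distribution(2)[OF _ assms]) simp

lemma integral_spectrum_law_tendsto:
  fixes f :: "nat \<Rightarrow> real \<Rightarrow> real"
  assumes "N > 0" "\<And>m. f m \<in> borel_measurable borel" "g \<in> borel_measurable borel" "\<And>x. (\<lambda>m. f m x) \<longlonglongrightarrow> g x"
  shows "(\<lambda>m. \<integral>x. f m x \<partial>spectrum_law N b \<omega>) \<longlonglongrightarrow> (\<integral>x. g x \<partial>spectrum_law N b \<omega>)"
  unfolding spectrum_law_def by (rule integral_eigenvalue_distribution_tendsto[OF _ assms]) simp

text \<open>
  Integrals of polynomials are combinations of trace moments and hence measurable; a continuous
  function is a pointwise limit of polynomials, which suffices for finitely supported measures.
\<close>
lemma borel_measurable_integral_spectrum_law: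
  fixes f :: "real \<Rightarrow> real"
  assumes N: "N > 0" and f: "continuous_on UNIV f"
  shows "(\<lambda>\<omega>. \<integral>x. f x \<partial>spectrum_law N b \<omega>) \<in> borel_measurable M"
proof -
  obtain p where p: "\<And>n. real_polynomial_function (p n)" "\<And>x. (\<lambda>n. p n x) \<longlonglongrightarrow> f x"
    using continuous_polynomial_approximation[OF f] by metis
  have pm: "p n \<in> borel_measurable borel" for n
    using continuous_on_polymonial_function[of "p n" UNIV] p(1)
    by (intro borel_measurable_continuous_onI) (simp add: real_polynomial_function_eq)
  have fm: "f \<in> borel_measurable borel" by (rule borel_measurable_continuous_onI[OF f])
  have "(\<lambda>\<omega>. \<integral>x. p n x \<partial>spectrum_law N b \<omega>) \<in> borel_measurable M" for n
  proof -
    obtain c d where c: "p n = (\<lambda>x. \<Sum>i\<le>d. c i * x ^ i)"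
      using p(1)[of n] unfolding real_polynomial_function_iff_sum by blast
    have "(\<integral>x. p n x \<partial>spectrum_law N b \<omega>) = (\<Sum>i\<le>d. c i * real_moment N b i \<omega>)" if "\<omega> \<in> space M" for \<omega>
      unfolding c by (subst Bochner_Integration.integral_sum)
        (auto simp: real_moment_eq[OF that N] spectrum_law_def[symmetric] intro!: integrable_mult_right integrable_spectrum_law[OF N])
    then show ?thesis by (subst measurable_cong) (assumption, measurable)
  qed
  then show ?thesis
    by (rule borel_measurable_LIMSEQ_real[rotated]) (rule integral_spectrum_law_tendsto[OF N pm fm p(2)])
qed

text \<open>Half-lines are limits of continuous functions, and so the random measure is a kernel.\<close>
lemma measurable_spectrum_law:
  assumes N: "N > 0"
  shows "spectrum_law N b \<in> measurable M (subprob_algebra borel)"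
proof (rule measurable_subprob_algebra_generated[where \<Omega> = UNIV and G = "range (\<lambda>a::real. {..a})"])
  show "sets (borel :: real measure) = sigma_sets UNIV (range (\<lambda>a::real. {..a}))"
    by (subst borel_eq_atMost) simp
  show "Int_stable (range (\<lambda>a::real. {..a}))"
    by (auto simp: Int_stable_def)
  show "subprob_space (spectrum_law N b \<omega>)" for \<omega>
    using prob_space_spectrum_law by (rule prob_space_imp_subprob_space)
  show "(\<lambda>\<omega>. emeasure (spectrum_law N b \<omega>) UNIV) \<in> borel_measurable M"
    using prob_space.emeasure_space_1[OF prob_space_spectrum_law] by simp
  fix A assume "A \<in> range (\<lambda>a::real. {..a})"
  then obtain y where A: "A = {..y}" by blast
  define h where "h n x = max 0 (min 1 (1 - real n * (x - y)))" for n x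
  have hc: "continuous_on UNIV (h n)" for n unfolding h_def by (intro continuous_intros)
  have hm: "h n \<in> borel_measurable borel" for n by (rule borel_measurable_continuous_onI[OF hc])
  have lim: "(\<lambda>n. h n x) \<longlonglongrightarrow> indicator A x" for x
  proof (cases "x \<le> y")
    case True
    then have "h n x = 1" for n by (simp add: h_def mult_nonneg_nonpos)
    then show ?thesis using True by (simp add: A)
  next
    case False
    have "\<forall>\<^sub>F n in sequentially. h n x = 0"
      using eventually_ge_at_top[of "nat \<lceil>1 / (x - y)\<rceil>"]
    proof eventually_elim
      case (elim n)
      then have "1 / (x - y) \<le> real n" by (simp add: nat_ceiling_le_eq)
      then have "1 \<le> real n * (x - y)" using False by (simp add: field_simps)
      then show ?case by (simp add: h_def)
    qed
    then show ?thesis using False by (simp add: A tendsto_eventually)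
  qed
  have "(\<lambda>\<omega>. \<integral>x. (indicator A x :: real) \<partial>spectrum_law N b \<omega>) \<in> borel_measurable M" (is "?i \<in> _")
  proof (rule borel_measurable_LIMSEQ_real)
    show "(\<lambda>n. \<integral>x. h n x \<partial>spectrum_law N b \<omega>) \<longlonglongrightarrow> ?i \<omega>" for \<omega>
      by (rule integral_spectrum_law_tendsto[OF N hm _ lim]) (simp add: A)
    show "(\<lambda>\<omega>. \<integral>x. h n x \<partial>spectrum_law N b \<omega>) \<in> borel_measurable M" for n
      by (rule borel_measurable_integral_spectrum_law[OF N hc])
  qed
  moreover have "emeasure (spectrum_law N b \<omega>) A = ennreal (?i \<omega>)" for \<omega>
  proof -
    interpret S: prob_space "spectrum_law N b \<omega>" by (rule prob_space_spectrum_law)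
    show ?thesis by (simp add: A S.emeasure_eq_measure)
  qed
  ultimately show "(\<lambda>\<omega>. emeasure (spectrum_law N b \<omega>) A) \<in> borel_measurable M" by simp
qed auto

definition mean_law :: "nat \<Rightarrow> nat \<Rightarrow> real measure" where
  "mean_law N b = M \<bind> spectrum_law N b"

lemma real_distribution_mean_law:
  assumes "N > 0"
  shows "real_distribution (mean_law N b)"
proof -
  have "prob_space (mean_law N b)" unfolding mean_law_def
    by (rule prob_space_bind[OF _ measurable_spectrum_law[OF assms]]) (auto intro: prob_space_spectrum_law)
  moreover have "sets (mean_law N b) = sets borel" unfolding mean_law_def
    by (rule sets_bind[OF _ not_empty]) simp
  moreover from this have "space (mean_law N b) = UNIV" using sets_eq_imp_space_eq by fastforce
  ultimately show ?thesis by (simp add: real_distribution_def real_distribution_axioms_def)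
qed

lemma integral_mean_law:
  fixes f :: "real \<Rightarrow> real"
  assumes "N > 0" "f \<in> borel_measurable borel" "\<And>x. \<bar>f x\<bar> \<le> B"
  shows "(\<integral>x. f x \<partial>mean_law N b) = (\<integral>\<omega>. (\<integral>x. f x \<partial>spectrum_law N b \<omega>) \<partial>M)"
  unfolding mean_law_def
proof (rule integral_bind[OF assms(2) _ measurable_spectrum_law[OF assms(1)]])
  show "AE \<omega> in M. emeasure (spectrum_law N b \<omega>) (space (spectrum_law N b \<omega>)) \<le> ennreal 1"
    using prob_space.emeasure_space_1[OF prob_space_spectrum_law] by simp
qed (use assms(3) finite_measure_axioms in auto)

lemma char_mean_law:
  assumes N: "N > 0"
  shows "integrable M (\<lambda>\<omega>. char (spectrum_law N b \<omega>) t)"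
    and "char (mean_law N b) t = (\<integral>\<omega>. char (spectrum_law N b \<omega>) t \<partial>M)"
proof -
  note ReIm = Re_Im_char[OF real_distribution_spectrum_law]
  have m: "(\<lambda>\<omega>. char (spectrum_law N b \<omega>) t) \<in> borel_measurable M"
    unfolding borel_measurable_complex_iff ReIm
    by (intro conjI borel_measurable_integral_spectrum_law N continuous_intros)
  show i: "integrable M (\<lambda>\<omega>. char (spectrum_law N b \<omega>) t)"
    by (rule integrable_const_bound[OF _ m, of 1])
       (auto intro!: real_distribution.cmod_char_le_1 real_distribution_spectrum_law)
  show "char (mean_law N b) t = (\<integral>\<omega>. char (spectrum_law N b \<omega>) t \<partial>M)"
  proof (rule complex_eqI)
    have "Re (char (mean_law N b) t) = (\<integral>\<omega>. (\<integral>x. cos (t * x) \<partial>spectrum_law N b \<omega>) \<partial>M)"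
      unfolding Re_Im_char[OF real_distribution_mean_law[OF N]]
      by (rule integral_mean_law[OF N, of _ 1]) auto
    then show "Re (char (mean_law N b) t) = Re (\<integral>\<omega>. char (spectrum_law N b \<omega>) t \<partial>M)"
      by (simp only: integral_Re[OF i, symmetric] ReIm)
    have "Im (char (mean_law N b) t) = (\<integral>\<omega>. (\<integral>x. sin (t * x) \<partial>spectrum_law N b \<omega>) \<partial>M)"
      unfolding Re_Im_char[OF real_distribution_mean_law[OF N]]
      by (rule integral_mean_law[OF N, of _ 1]) auto
    then show "Im (char (mean_law N b) t) = Im (\<integral>\<omega>. char (spectrum_law N b \<omega>) t \<partial>M)"
      by (simp only: integral_Im[OF i, symmetric] ReIm)
  qed
qed

text \<open>
  The pointwise Taylor bound is integrated over \<open>\<omega>\<close>; this avoids unbounded integrands with respect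
  to the mean measure.
\<close>
lemma char_mean_law_taylor:
  assumes N: "N > 0"
  shows "cmod (char (mean_law N b) t - (\<Sum>k\<le>2 * p. (\<i> * t) ^ k / fact k * (\<integral>\<omega>. real_moment N b k \<omega> \<partial>M)))
     \<le> 2 * \<bar>t\<bar> ^ (2 * p) / fact (2 * p) * (\<integral>\<omega>. real_moment N b (2 * p) \<omega> \<partial>M)"
proof -
  let ?T = "\<lambda>\<omega>. \<Sum>k\<le>2 * p. (\<i> * t) ^ k / fact k * complex_of_real (real_moment N b k \<omega>)"
  let ?R = "\<lambda>\<omega>. 2 * \<bar>t\<bar> ^ (2 * p) / fact (2 * p) * real_moment N b (2 * p) \<omega>"
  have iT: "integrable M (\<lambda>\<omega>. (\<i> * t) ^ k / fact k * complex_of_real (real_moment N b k \<omega>))" for k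
    by (intro integrable_mult_right integrable_of_real integrable_real_moment)
  have iT': "integrable M ?T" by (intro Bochner_Integration.integrable_sum iT)
  have iR: "integrable M ?R" by (intro integrable_mult_right integrable_real_moment)
  have iD: "integrable M (\<lambda>\<omega>. char (spectrum_law N b \<omega>) t - ?T \<omega>)"
    by (intro Bochner_Integration.integrable_diff char_mean_law(1)[OF N] iT')
  have le: "cmod (char (spectrum_law N b \<omega>) t - ?T \<omega>) \<le> ?R \<omega>" if "\<omega> \<in> space M" for \<omega>
  proof -
    have "integrable (spectrum_law N b \<omega>) (\<lambda>x. x ^ k)" for k
      by (rule integrable_spectrum_law[OF N]) simp
    from char_taylor_bound[OF real_distribution_spectrum_law this, of t p] show ?thesis
      by (simp only: real_moment_eq[OF that N] spectrum_law_def)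
  qed
  have "(\<integral>\<omega>. ?T \<omega> \<partial>M) = (\<Sum>k\<le>2 * p. (\<i> * t) ^ k / fact k * (\<integral>\<omega>. real_moment N b k \<omega> \<partial>M))"
    by (simp only: Bochner_Integration.integral_sum[OF iT] integral_mult_right_zero integral_complex_of_real)
  then have "char (mean_law N b) t - (\<Sum>k\<le>2 * p. (\<i> * t) ^ k / fact k * (\<integral>\<omega>. real_moment N b k \<omega> \<partial>M))
      = (\<integral>\<omega>. char (spectrum_law N b \<omega>) t - ?T \<omega> \<partial>M)"
    by (simp only: char_mean_law(2)[OF N] Bochner_Integration.integral_diff[OF char_mean_law(1)[OF N] iT'])
  also have "cmod \<dots> \<le> (\<integral>\<omega>. cmod (char (spectrum_law N b \<omega>) t - ?T \<omega>) \<partial>M)"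
    by (rule integral_norm_bound)
  also have "\<dots> \<le> (\<integral>\<omega>. ?R \<omega> \<partial>M)"
    by (rule integral_mono[OF integrable_norm[OF iD] iR le])
  finally show ?thesis by simp
qed

lemma mean_law_weak_conv:
  assumes "filterlim b at_top sequentially" "(\<lambda>N. real (b N) / real N) \<longlonglongrightarrow> 0"
  \<comment> \<open>The shift by one avoids the empty matrix.\<close>
  shows "weak_conv_m (\<lambda>n. mean_law (Suc n) (b (Suc n))) std_normal_distribution"
proof (rule levy_continuity[OF _ real_dist_normal_dist])
  show "real_distribution (mean_law (Suc n) (b (Suc n)))" for n
    by (rule real_distribution_mean_law) simp
  show "(\<lambda>n. char (mean_law (Suc n) (b (Suc n))) t) \<longlonglongrightarrow> char std_normal_distribution t" for t
  proof (rule char_tendsto_of_moments)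
    show "cmod (char (mean_law (Suc n) (b (Suc n))) t
          - (\<Sum>k\<le>2 * p. (\<i> * t) ^ k / fact k * (\<integral>\<omega>. real_moment (Suc n) (b (Suc n)) k \<omega> \<partial>M)))
        \<le> 2 * \<bar>t\<bar> ^ (2 * p) / fact (2 * p) * (\<integral>\<omega>. real_moment (Suc n) (b (Suc n)) (2 * p) \<omega> \<partial>M)" for n p
      by (rule char_mean_law_taylor) simp
    show "(\<lambda>n. \<integral>\<omega>. real_moment (Suc n) (b (Suc n)) k \<omega> \<partial>M) \<longlonglongrightarrow> normal_moment k" for k
      by (rule LIMSEQ_Suc[OF expectation_real_moment_tendsto[OF assms]])
  qed
qed

lemma expectation_integral_spectrum_law_tendsto:
  fixes f :: "real \<Rightarrow> real"
  assumes b: "filterlim b at_top sequentially" "(\<lambda>N. real (b N) / real N) \<longlonglongrightarrow> 0"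
    and f: "continuous_on UNIV f" "bounded (range f)"
  shows "(\<lambda>N. \<integral>\<omega>. (\<integral>x. f x \<partial>spectrum_law N (b N) \<omega>) \<partial>M) \<longlonglongrightarrow> (\<integral>x. f x \<partial>std_normal_distribution)"
proof -
  obtain B where B: "\<And>x. \<bar>f x\<bar> \<le> B" using f(2) by (auto simp: bounded_iff)
  have "(\<lambda>n. \<integral>x. f x \<partial>mean_law (Suc n) (b (Suc n))) \<longlonglongrightarrow> (\<integral>x. f x \<partial>std_normal_distribution)"
  proof (rule weak_conv_imp_integral_bdd_continuous_conv[OF _ real_dist_normal_dist mean_law_weak_conv[OF b]])
    show "real_distribution (mean_law (Suc n) (b (Suc n)))" for n
      by (rule real_distribution_mean_law) simp
    show "isCont f x" for x using f(1) by (simp add: continuous_on_eq_continuous_at)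
    show "norm (f x) \<le> B" for x using B by simp
  qed
  then have "(\<lambda>n. \<integral>\<omega>. (\<integral>x. f x \<partial>spectrum_law (Suc n) (b (Suc n)) \<omega>) \<partial>M) \<longlonglongrightarrow> (\<integral>x. f x \<partial>std_normal_distribution)"
    by (subst (asm) integral_mean_law[OF _ borel_measurable_continuous_onI[OF f(1)] B]) auto
  then show ?thesis by (rule LIMSEQ_imp_Suc)
qed

lemma AE_spectrum_law_weak_conv:
  assumes b: "filterlim b at_top sequentially" "(\<lambda>N. real (b N) / real N) \<longlonglongrightarrow> 0"
    and summ: "summable (\<lambda>N. 1 / (real (b N))\<^sup>2)"
  shows "AE \<omega> in M. weak_conv_m (\<lambda>N. spectrum_law N (b N) \<omega>) std_normal_distribution"
proof -
  have "AE \<omega> in M. \<forall>k. (\<lambda>N. real_moment N (b N) k \<omega>) \<longlonglongrightarrow> normal_moment k"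
    unfolding AE_all_countable using AE_real_moment_tendsto[OF b summ] by blast
  then show ?thesis
    using AE_space
  proof eventually_elim
    case (elim \<omega>)
    show ?case
    proof (rule weak_conv_m_normal_of_moments[OF real_distribution_spectrum_law, of 1])
      show "integrable (spectrum_law N (b N) \<omega>) (\<lambda>x. x ^ k)" if "N \<ge> 1" for N k
        by (rule integrable_spectrum_law) (use that in auto)
      fix k
      have "\<forall>\<^sub>F N in sequentially. real_moment N (b N) k \<omega> = (\<integral>x. x ^ k \<partial>spectrum_law N (b N) \<omega>)"
        using eventually_gt_at_top[of 0]
        by eventually_elim (simp add: real_moment_eq[OF elim(2)] spectrum_law_def)
      from Lim_transform_eventually[OF elim(1)[rule_format, of k] this]
      show "(\<lambda>N. \<integral>x. x ^ k \<partial>spectrum_law N (b N) \<omega>) \<longlonglongrightarrow> normal_moment k" .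
    qed
  qed
qed

end

section \<open>The limit theorem for banded Toeplitz matrices\<close>

lemma integral_std_normal_distribution:
  fixes f :: "real \<Rightarrow> real"
  assumes "f \<in> borel_measurable borel"
  shows "(\<integral>x. f x \<partial>std_normal_distribution) = 1 / sqrt (2 * pi) * (\<integral>x. f x * exp (- x\<^sup>2 / 2) \<partial>lborel)"
proof -
  have "(\<integral>x. f x \<partial>std_normal_distribution) = (\<integral>x. std_normal_density x * f x \<partial>lborel)"
    using assms by (subst integral_density) (auto simp: std_normal_density_def)
  also have "\<dots> = (\<integral>x. 1 / sqrt (2 * pi) * (f x * exp (- x\<^sup>2 / 2)) \<partial>lborel)"
    by (rule Bochner_Integration.integral_cong[OF refl]) (simp add: std_normal_density_def)
  also have "\<dots> = 1 / sqrt (2 * pi) * (\<integral>x. f x * exp (- x\<^sup>2 / 2) \<partial>lborel)"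
    by (rule integral_mult_right_zero)
  finally show ?thesis .
qed

lemma summable_inverse_square_of_powr:
  fixes b :: "nat \<Rightarrow> nat"
  assumes "\<epsilon> > 0" "C > 0" "\<forall>\<^sub>F N in sequentially. real (b N) \<ge> C * real N powr (1 / 2 + \<epsilon>)"
  shows "summable (\<lambda>N. 1 / (real (b N))\<^sup>2)"
proof (rule summable_comparison_test_ev)
  show "summable (\<lambda>N. 1 / C\<^sup>2 * real N powr (- (1 + 2 * \<epsilon>)))"
    by (rule summable_mult) (use assms(1) in \<open>simp add: summable_real_powr_iff\<close>)
  show "\<forall>\<^sub>F N in sequentially. norm (1 / (real (b N))\<^sup>2) \<le> 1 / C\<^sup>2 * real N powr (- (1 + 2 * \<epsilon>))"
    using assms(3) eventually_gt_at_top[of 0]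
  proof eventually_elim
    case (elim N)
    have pos: "0 < C * real N powr (1 / 2 + \<epsilon>)" using elim assms(2) by simp
    have "(C * real N powr (1 / 2 + \<epsilon>))\<^sup>2 = C\<^sup>2 * real N powr (1 + 2 * \<epsilon>)"
      by (simp add: power_mult_distrib power2_eq_square powr_add[symmetric])
    then have le: "C\<^sup>2 * real N powr (1 + 2 * \<epsilon>) \<le> (real (b N))\<^sup>2"
      using power_mono[OF elim(1), of 2] pos by simp
    have "0 < C\<^sup>2 * real N powr (1 + 2 * \<epsilon>)" using elim assms(2) by simp
    then have "1 / (real (b N))\<^sup>2 \<le> 1 / (C\<^sup>2 * real N powr (1 + 2 * \<epsilon>))"
      by (rule frac_le[OF zero_le_one order_refl _ le])
    also have "\<dots> = 1 / C\<^sup>2 * real N powr (- (1 + 2 * \<epsilon>))"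
      by (simp only: powr_minus divide_inverse inverse_mult_distrib mult_1_left)
    finally show ?case by simp
  qed
qed

theorem theorem3p1:
  fixes M :: "'a measure" and a :: "int \<Rightarrow> 'a \<Rightarrow> complex" and b :: "nat \<Rightarrow> nat"
    and X :: "nat \<Rightarrow> 'a \<Rightarrow> complex mat"
  assumes "prob_space M"
    and "hermitian_input M a \<or> symmetric_input M a"
    and "\<And>N. N \<ge> 1 \<Longrightarrow> b N < N"
    and "filterlim b at_top sequentially"
    and "(\<lambda>N. real (b N) / real N) \<longlonglongrightarrow> 0"
  defines "X \<equiv> (\<lambda>N \<omega>. normalized_band_toeplitz N (b N) (\<lambda>j. a j \<omega>))"
  shows "(\<forall>f :: real \<Rightarrow> real. continuous_on UNIV f \<and> bounded (range f) \<longrightarrow>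
            (\<lambda>N. \<integral>\<omega>. (\<integral>x. f x \<partial>eigenvalue_distribution (X N \<omega>)) \<partial>M)
              \<longlonglongrightarrow> 1 / sqrt (2 * pi) * (\<integral>x. f x * exp (- x\<^sup>2 / 2) \<partial>lborel))
       \<and> ((\<exists>\<epsilon>\<^sub>0 > 0. \<exists>C > 0. \<forall>\<^sub>F N in sequentially. real (b N) \<ge> C * real N powr (1 / 2 + \<epsilon>\<^sub>0)) \<longrightarrow>
            (AE \<omega> in M. weak_conv_m (\<lambda>N. eigenvalue_distribution (X N \<omega>)) std_normal_distribution))"
proof -
  interpret toeplitz_input M a
    using toeplitz_input_of_hermitian[OF assms(1)] toeplitz_input_of_symmetric[OF assms(1)] assms(2) by blast
  have X: "eigenvalue_distribution (X N \<omega>) = spectrum_law N (b N) \<omega>" for N \<omega>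
    by (simp add: X_def spectrum_law_def)
  show ?thesis
    unfolding X
  proof (intro conjI allI impI)
    fix f :: "real \<Rightarrow> real" assume f: "continuous_on UNIV f \<and> bounded (range f)"
    then have c: "continuous_on UNIV f" and bd: "bounded (range f)" by auto
    show "(\<lambda>N. \<integral>\<omega>. (\<integral>x. f x \<partial>spectrum_law N (b N) \<omega>) \<partial>M)
        \<longlonglongrightarrow> 1 / sqrt (2 * pi) * (\<integral>x. f x * exp (- x\<^sup>2 / 2) \<partial>lborel)"
      unfolding integral_std_normal_distribution[OF borel_measurable_continuous_onI[OF c], symmetric]
      by (rule expectation_integral_spectrum_law_tendsto[OF assms(4,5) c bd])
  next
    assume "\<exists>\<epsilon>\<^sub>0>0. \<exists>C>0. \<forall>\<^sub>F N in sequentially. real (b N) \<ge> C * real N powr (1 / 2 + \<epsilon>\<^sub>0)"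
    then obtain \<epsilon> C where "\<epsilon> > 0" "C > 0"
      "\<forall>\<^sub>F N in sequentially. real (b N) \<ge> C * real N powr (1 / 2 + \<epsilon>)" by blast
    then have "summable (\<lambda>N. 1 / (real (b N))\<^sup>2)" by (rule summable_inverse_square_of_powr)
    then show "AE \<omega> in M. weak_conv_m (\<lambda>N. spectrum_law N (b N) \<omega>) std_normal_distribution"
      by (rule AE_spectrum_law_weak_conv[OF assms(4,5)])
  qed
qed

end
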